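(* Let $\mathcal{C}^{Ber}=\mathcal{C}(\mathcal{P}^{Ber},m^{Ber},n)$ and $\mathcal{F}^{Ber}=\mathcal{F}(\mathcal{P}^{Ber},m^{Ber},c)$ be the Bernoulli conditional independence testing problem and the Bernoulli poly-forest learning problem on $d$ nodes, and let $\psi^{Ber}=\mathbf{1}\{\widehat m^{Ber}(X,Y\mid Z)\ge c/2\}$ be the plug-in test. Then $\psi^{Ber}$ is optimal for $\mathcal{C}^{Ber}$, with optimal testing radius $r_n\asymp n^{-1/2}$, and the optimal sample complexity of learning $\mathcal{F}^{Ber}$ is $$n\asymp\frac{\log d}{c^{2}},$$ which is achieved by the PC-tree algorithm with $\psi^{Ber}$.
   Context: Graphs. A poly-forest is a DAG whose skeleton is a forest (any two nodes connected by at most one path); $\mathcal{T}_d$ is the set of poly-forests on $[d]$. A $v$-structure is $k\to\ell\leftarrow j$ with $j,k$ non-adjacent. $\overline{G}$ is the CPDAG representing the Markov equivalence class of $G$. $p$ is Markov to $G$ if $p(X)=\prod_k p(X_k\mid X_{\mathrm{pa}(k)})$. Bernoulli model. $\mathcal{P}^{Ber}$ is the set of all probability mass functions $p(x,y,z)$ on $\{0,1\}^3$. Dependence is measured by $$m^{Ber}(X,Y\mid Z)=\sum_z p(z)\sum_{x,y}\big|p(x,y\mid z)-p(x\mid z)p(y\mid z)\big|,$$ and for $Z=\emptyset$ by $\sum_{x,y}|p(x,y)-p(x)p(y)|$. $\widehat m^{Ber}$ is the same expression with all probabilities replaced by empirical frequencies from the $n$ samples. $c$-strong tree-faithfulness.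 $p$ is $c$-strong tree-faithful to a poly-forest $G=(V,E)$ with respect to $m$ if (1) for every pair of adjacent nodes $j-k$, $m(X_k;X_j\mid X_\ell)\ge c$ for all $\ell\in(V\cup\{\emptyset\})\setminus\{k,j\}$ ($\ell=\emptyset$ means no conditioning); and (2) for every $v$-structure $k\to\ell\leftarrow j$, $m(X_k;X_j\mid X_\ell)\ge c$. CI testing problem $\mathcal{C}(\mathcal{P},m,n)$. From $n$ i.i.d. samples of $(X,Y,Z)\sim p\in\mathcal{P}$, distinguish $\mathcal{H}_0=\{p\in\mathcal{P}:X\perp\!\!\!\perp Y\mid Z\}$ from $\mathcal{H}_1=\{p\in\mathcal{P}:m(X;Y\mid Z)\ge r\}$ (in $\psi^{Ber}$ the threshold parameter $c$ is identified with $r$). A test is a $\{0,1\}$-valued function of the sample ($0$ selects $\mathcal{H}_0$). The minimax optimal testing radius $r_n$ is the infimum (in terms of $n$, up to constants) of $r>0$ such that $\inf_\psi\{\sup_{\mathcal{H}_0}\mathbb{E}_p[\psi]+\sup_{\mathcal{H}_1}\mathbb{E}_p[1-\psi]\}\le1/10$; a test is optimal if it attains this error control at a radius of order $r_n$. Poly-forest learning problem $\mathcal{F}(\mathcal{P},m,c)$. The set of pairs $(p,G)$ with $G\in\mathcal{T}_d$, $p$ Markov and $c$-strong tree-faithful to $G$ with respect to $m$, and the law of $(X_j,X_k,X_\ell)$ in $\mathcal{P}$ for all $j,k,\ell\in[d]$; so $\mathcal{F}^{Ber}$ consists of laws on $\{0,1\}^d$. Its optimal sample complexity (in terms of $d$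 and $c$, up to constants) is $\inf\{n:\exists\,\widehat G\text{ based on }n\text{ i.i.d. samples with }\sup_{(p,G)\in\mathcal{F}}\mathbb{P}(\widehat G\ne\overline{G})\le1/10\}$. An estimator achieves it if it has this guarantee for some $n$ of that order. The constant $1/10$ may be replaced by any fixed small constant. PC-tree with a CI test $\psi$. For each pair $j<k$ in $[d]$ and each $\ell\in([d]\cup\{\emptyset\})\setminus\{j,k\}$, test $X_j\perp\!\!\!\perp X_k\mid X_\ell$ with $\psi$. If all tests reject, put $j-k$ in the skeleton; otherwise let $S(j,k)$ be the set of those $\ell$ for which the test accepts. Then for each pair of non-adjacent $j,k$ with common neighbour $\ell$, if $\ell\notin S(j,k)$ orient $j\to\ell\leftarrow k$; finally orient further edges by the standard Meek rules and output the resulting graph. Convention: $a\asymp b$ means equality up to positive multiplicative constants. *)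

theory Defs
  imports "HOL-Probability.Probability" "HOL-Probability.Product_PMF"
begin

text \<open>The node set $[d]$ is \<open>{..<d}\<close>. A directed graph on it is its edge set \<open>E\<close>, where
  \<open>(a, b) \<in> E\<close> is the edge $a \to b$.\<close>

section \<open>Graphs\<close>

definition is_dag :: "nat \<Rightarrow> (nat \<times> nat) set \<Rightarrow> bool" where
  "is_dag d E \<longleftrightarrow> E \<subseteq> {..<d} \<times> {..<d} \<and> acyclic E"

definition skeleton :: "(nat \<times> nat) set \<Rightarrow> (nat \<times> nat) set" where
  "skeleton E = E \<union> E\<inverse>"

definition skel_path :: "(nat \<times> nat) set \<Rightarrow> nat \<Rightarrow> nat \<Rightarrow> nat list \<Rightarrow> bool" where
  "skel_path E a b xs \<longleftrightarrow> xs \<noteq> [] \<and> hd xs = a \<and> last xs = b \<and> distinct xs \<and>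
     successively (\<lambda>u v. (u, v) \<in> skeleton E) xs"

definition poly_forests :: "nat \<Rightarrow> (nat \<times> nat) set set" where
  "poly_forests d = {E. is_dag d E \<and>
     (\<forall>a b xs ys. skel_path E a b xs \<longrightarrow> skel_path E a b ys \<longrightarrow> xs = ys)}"

text \<open>\<open>v_structure E k l j\<close> is $k \to l \leftarrow j$ with $k$, $j$ non-adjacent.\<close>

definition v_structure :: "(nat \<times> nat) set \<Rightarrow> nat \<Rightarrow> nat \<Rightarrow> nat \<Rightarrow> bool" where
  "v_structure E k l j \<longleftrightarrow> (k, l) \<in> E \<and> (j, l) \<in> E \<and> k \<noteq> j \<and> (k, j) \<notin> skeleton E"

definition parents :: "(nat \<times> nat) set \<Rightarrow> nat \<Rightarrow> nat set" where
  "parents E k = {j. (j, k) \<in> E}"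

text \<open>A path is blocked by \<open>Z\<close> at an interior node that is either a non-collider in \<open>Z\<close> or a
  collider none of whose descendants (itself included) is in \<open>Z\<close>.\<close>

definition path_blocked :: "(nat \<times> nat) set \<Rightarrow> nat set \<Rightarrow> nat list \<Rightarrow> bool" where
  "path_blocked E Z xs \<longleftrightarrow> (\<exists>i. 0 < i \<and> i + 1 < length xs \<and>
     (if (xs ! (i - 1), xs ! i) \<in> E \<and> (xs ! (i + 1), xs ! i) \<in> E
      then \<forall>z\<in>Z. (xs ! i, z) \<notin> E\<^sup>*
      else xs ! i \<in> Z))"

definition d_separated :: "(nat \<times> nat) set \<Rightarrow> nat \<Rightarrow> nat \<Rightarrow> nat set \<Rightarrow> bool" where
  "d_separated E a b Z \<longleftrightarrow> (\<forall>xs. skel_path E a b xs \<longrightarrow> path_blocked E Z xs)"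

text \<open>Two DAGs are Markov equivalent if they have the same d-separations. For sets of nodes,
  d-separation is nodewise, so single nodes suffice.\<close>

definition markov_equivalent :: "nat \<Rightarrow> (nat \<times> nat) set \<Rightarrow> (nat \<times> nat) set \<Rightarrow> bool" where
  "markov_equivalent d E E' \<longleftrightarrow> is_dag d E \<and> is_dag d E' \<and>
     (\<forall>a<d. \<forall>b<d. \<forall>Z. a \<noteq> b \<longrightarrow> Z \<subseteq> {..<d} - {a, b} \<longrightarrow>
        d_separated E a b Z = d_separated E' a b Z)"

text \<open>A partially directed graph is a pair (skeleton, arrows): a symmetric set of adjacent pairs and
  the set of those pairs \<open>(a, b)\<close> whose edge is oriented $a \to b$. In a CPDAG an edge is
  oriented iff it has the same orientation in every member of the Markov equivalence class.\<close>

type_synonym pdag = "(nat \<times> nat) set \<times> (nat \<times> nat) set"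

definition cpdag :: "nat \<Rightarrow> (nat \<times> nat) set \<Rightarrow> pdag" where
  "cpdag d E = (skeleton E, {e \<in> E. \<forall>E'. markov_equivalent d E E' \<longrightarrow> e \<in> E'})"

section \<open>The Bernoulli dependence measure\<close>

text \<open>The measure is a function of a mass function \<open>q\<close>, so that the plug-in version is
  the same expression at the empirical frequencies. Values \<open>z\<close> of mass zero contribute zero.\<close>

definition mXZ :: "(bool \<times> bool \<times> bool \<Rightarrow> real) \<Rightarrow> bool \<Rightarrow> bool \<Rightarrow> real" where
  "mXZ q x z = (\<Sum>y\<in>UNIV. q (x, y, z))"

definition mYZ :: "(bool \<times> bool \<times> bool \<Rightarrow> real) \<Rightarrow> bool \<Rightarrow> bool \<Rightarrow> real" where
  "mYZ q y z = (\<Sum>x\<in>UNIV. q (x, y, z))"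

definition mZ :: "(bool \<times> bool \<times> bool \<Rightarrow> real) \<Rightarrow> bool \<Rightarrow> real" where
  "mZ q z = (\<Sum>x\<in>UNIV. \<Sum>y\<in>UNIV. q (x, y, z))"

definition m_ber :: "(bool \<times> bool \<times> bool \<Rightarrow> real) \<Rightarrow> real" where
  "m_ber q = (\<Sum>z\<in>UNIV. mZ q z * (\<Sum>x\<in>UNIV. \<Sum>y\<in>UNIV.
     \<bar>q (x, y, z) / mZ q z - (mXZ q x z / mZ q z) * (mYZ q y z / mZ q z)\<bar>))"

definition m_ber0 :: "(bool \<times> bool \<Rightarrow> real) \<Rightarrow> real" where
  "m_ber0 q = (\<Sum>x\<in>UNIV. \<Sum>y\<in>UNIV.
     \<bar>q (x, y) - (\<Sum>y'\<in>UNIV. q (x, y')) * (\<Sum>x'\<in>UNIV. q (x', y))\<bar>)"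

text \<open>A sample of size \<open>n\<close> is a function on \<open>{..<n}\<close>; its values elsewhere are a fixed dummy.\<close>

definition iid :: "nat \<Rightarrow> 'a pmf \<Rightarrow> (nat \<Rightarrow> 'a) pmf" where
  "iid n p = Pi_pmf {..<n} undefined (\<lambda>_. p)"

definition emp :: "nat \<Rightarrow> (nat \<Rightarrow> 'a) \<Rightarrow> 'a \<Rightarrow> real" where
  "emp n s v = real (card {i. i < n \<and> s i = v}) / real n"

text \<open>The plug-in tests, with and without conditioning variable; \<open>True\<close> means rejection.\<close>

definition psi_ber :: "real \<Rightarrow> nat \<Rightarrow> (nat \<Rightarrow> bool \<times> bool \<times> bool) \<Rightarrow> bool" where
  "psi_ber c n s \<longleftrightarrow> m_ber (emp n s) \<ge> c / 2"

definition psi_ber0 :: "real \<Rightarrow> nat \<Rightarrow> (nat \<Rightarrow> bool \<times> bool) \<Rightarrow> bool" where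
  "psi_ber0 c n s \<longleftrightarrow> m_ber0 (emp n s) \<ge> c / 2"

section \<open>Order equivalence\<close>

definition order_equiv :: "'t set \<Rightarrow> ('t \<Rightarrow> real) \<Rightarrow> ('t \<Rightarrow> real) \<Rightarrow> bool" where
  "order_equiv S f g \<longleftrightarrow>
     (\<exists>C1>0. \<exists>C2>0. \<forall>t\<in>S. C1 * g t \<le> f t \<and> f t \<le> C2 * g t)"

section \<open>Conditional independence testing\<close>

definition P_ber :: "(bool \<times> bool \<times> bool) pmf set" where
  "P_ber = UNIV"

definition cond_indep :: "(bool \<times> bool \<times> bool) pmf \<Rightarrow> bool" where
  "cond_indep p \<longleftrightarrow> (\<forall>x y z. mZ (pmf p) z > 0 \<longrightarrow>
     pmf p (x, y, z) / mZ (pmf p) z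
       = (mXZ (pmf p) x z / mZ (pmf p) z) * (mYZ (pmf p) y z / mZ (pmf p) z))"

definition H0 :: "(bool \<times> bool \<times> bool) pmf set" where
  "H0 = {p \<in> P_ber. cond_indep p}"

definition H1 :: "real \<Rightarrow> (bool \<times> bool \<times> bool) pmf set" where
  "H1 r = {p \<in> P_ber. m_ber (pmf p) \<ge> r}"

text \<open>Errors are in \<^typ>\<open>ennreal\<close>, where the supremum over an empty hypothesis is 0
  (\<open>H1 r\<close> is empty for \<open>r > 1\<close>).\<close>

definition test_error :: "nat \<Rightarrow> real \<Rightarrow> ((nat \<Rightarrow> bool \<times> bool \<times> bool) \<Rightarrow> bool) \<Rightarrow> ennreal" where
  "test_error n r \<psi> =
     (SUP p\<in>H0. emeasure (measure_pmf (iid n p)) {s. \<psi> s})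
     + (SUP p\<in>H1 r. emeasure (measure_pmf (iid n p)) {s. \<not> \<psi> s})"

definition test_radius :: "nat \<Rightarrow> real" where
  "test_radius n = Inf {r. r > 0 \<and> (INF \<psi>. test_error n r \<psi>) \<le> ennreal (1 / 10)}"

text \<open>A family of tests indexed by threshold and sample size is optimal if, at thresholds
  \<open>\<rho> n\<close> of the order of the optimal radius, it separates \<open>H0\<close> from \<open>H1 (\<rho> n)\<close>.\<close>

definition optimal_test :: "(real \<Rightarrow> nat \<Rightarrow> (nat \<Rightarrow> bool \<times> bool \<times> bool) \<Rightarrow> bool) \<Rightarrow> bool" where
  "optimal_test \<psi> \<longleftrightarrow> (\<exists>\<rho>. order_equiv {1..} \<rho> test_radius \<and>
     (\<forall>n\<ge>1. \<rho> n > 0 \<and> test_error n (\<rho> n) (\<psi> (\<rho> n) n) \<le> ennreal (1 / 10)))"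

section \<open>Poly-forest learning\<close>

text \<open>A conditioning node is an \<open>option\<close>; \<open>None\<close> stands for the empty conditioning set.\<close>

definition cond_nodes :: "nat \<Rightarrow> nat \<Rightarrow> nat \<Rightarrow> nat option set" where
  "cond_nodes d j k = insert None (Some ` ({..<d} - {j, k}))"

definition m_nodes :: "(nat \<Rightarrow> bool) pmf \<Rightarrow> nat \<Rightarrow> nat \<Rightarrow> nat option \<Rightarrow> real" where
  "m_nodes p j k l = (case l of
     None \<Rightarrow> m_ber0 (pmf (map_pmf (\<lambda>x. (x j, x k)) p))
   | Some i \<Rightarrow> m_ber (pmf (map_pmf (\<lambda>x. (x j, x k, x i)) p)))"

definition strong_tree_faithful ::
  "nat \<Rightarrow> real \<Rightarrow> (nat \<Rightarrow> bool) pmf \<Rightarrow> (nat \<times> nat) set \<Rightarrow> bool" where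
  "strong_tree_faithful d c p E \<longleftrightarrow>
     (\<forall>j k. (j, k) \<in> skeleton E \<longrightarrow> (\<forall>l\<in>cond_nodes d j k. m_nodes p k j l \<ge> c)) \<and>
     (\<forall>k l j. v_structure E k l j \<longrightarrow> m_nodes p k j (Some l) \<ge> c)"

definition cylinder :: "nat set \<Rightarrow> (nat \<Rightarrow> bool) \<Rightarrow> (nat \<Rightarrow> bool) set" where
  "cylinder A x = {y. \<forall>j\<in>A. y j = x j}"

text \<open>Each factor is $p(x_k \mid x_{pa(k)})$. If the conditioning event is null, both sides
  of the factorization vanish.\<close>

definition markov :: "nat \<Rightarrow> (nat \<Rightarrow> bool) pmf \<Rightarrow> (nat \<times> nat) set \<Rightarrow> bool" where
  "markov d p E \<longleftrightarrow> (\<forall>x \<in> {..<d} \<rightarrow>\<^sub>E UNIV. pmf p x =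
     (\<Prod>k<d. measure_pmf.prob p (cylinder (insert k (parents E k)) x)
             / measure_pmf.prob p (cylinder (parents E k) x)))"

text \<open>Laws on $\{0,1\}^d$ are laws supported on extensional functions on \<open>{..<d}\<close>.\<close>

definition F_ber :: "nat \<Rightarrow> real \<Rightarrow> ((nat \<Rightarrow> bool) pmf \<times> (nat \<times> nat) set) set" where
  "F_ber d c = {(p, E). E \<in> poly_forests d \<and> set_pmf p \<subseteq> {..<d} \<rightarrow>\<^sub>E UNIV \<and>
     markov d p E \<and> strong_tree_faithful d c p E \<and>
     (\<forall>j<d. \<forall>k<d. \<forall>l<d. map_pmf (\<lambda>x. (x j, x k, x l)) p \<in> P_ber)}"

definition learn_error :: "nat \<Rightarrow> real \<Rightarrow> nat \<Rightarrow> ((nat \<Rightarrow> nat \<Rightarrow> bool) \<Rightarrow> pdag) \<Rightarrow> ennreal" where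
  "learn_error d c n Ghat = (SUP (p, E)\<in>F_ber d c.
     emeasure (measure_pmf (iid n p)) {s. Ghat s \<noteq> cpdag d E})"

definition sample_complexity :: "nat \<Rightarrow> real \<Rightarrow> nat" where
  "sample_complexity d c = Inf {n. \<exists>Ghat. learn_error d c n Ghat \<le> ennreal (1 / 10)}"

section \<open>PC-tree\<close>

text \<open>\<open>rej j k l\<close> is the outcome of the test of $X_j$ against $X_k$ given $X_l$, for \<open>j < k\<close>;
  \<open>True\<close> means rejection.\<close>

type_synonym outcomes = "nat \<Rightarrow> nat \<Rightarrow> nat option \<Rightarrow> bool"

definition accepting :: "nat \<Rightarrow> outcomes \<Rightarrow> nat \<Rightarrow> nat \<Rightarrow> nat option set" where
  "accepting d rej j k = {l \<in> cond_nodes d j k. \<not> rej (min j k) (max j k) l}"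

definition pc_skeleton :: "nat \<Rightarrow> outcomes \<Rightarrow> (nat \<times> nat) set" where
  "pc_skeleton d rej = {(j, k). j < d \<and> k < d \<and> j \<noteq> k \<and> accepting d rej j k = {}}"

text \<open>All v-structure orientations are recorded; erroneous test outcomes may put arrows in both
  directions on the same edge.\<close>

definition pc_v_arrows :: "nat \<Rightarrow> outcomes \<Rightarrow> (nat \<times> nat) set" where
  "pc_v_arrows d rej = {(j, l). \<exists>k. j \<noteq> k \<and> (j, k) \<notin> pc_skeleton d rej \<and>
     (j, l) \<in> pc_skeleton d rej \<and> (k, l) \<in> pc_skeleton d rej \<and> Some l \<notin> accepting d rej j k}"

definition undirected :: "(nat \<times> nat) set \<Rightarrow> (nat \<times> nat) set \<Rightarrow> nat \<Rightarrow> nat \<Rightarrow> bool" where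
  "undirected S D a b \<longleftrightarrow> (a, b) \<in> S \<and> (a, b) \<notin> D \<and> (b, a) \<notin> D"

text \<open>One application of a Meek rule in the partially directed graph \<open>(S, D)\<close>, orienting the
  undirected edge $a - b$ as $a \to b$.\<close>

inductive meek_step :: "(nat \<times> nat) set \<Rightarrow> (nat \<times> nat) set \<Rightarrow> (nat \<times> nat) set \<Rightarrow> bool"
  for S where
  R1: "undirected S D a b \<Longrightarrow> (u, a) \<in> D \<Longrightarrow> u \<noteq> b \<Longrightarrow> (u, b) \<notin> S \<Longrightarrow>
         meek_step S D (insert (a, b) D)"
| R2: "undirected S D a b \<Longrightarrow> (a, u) \<in> D \<Longrightarrow> (u, b) \<in> D \<Longrightarrow>
         meek_step S D (insert (a, b) D)"
| R3: "undirected S D a b \<Longrightarrow> undirected S D a u \<Longrightarrow> undirected S D a w \<Longrightarrow>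
         (u, b) \<in> D \<Longrightarrow> (w, b) \<in> D \<Longrightarrow> u \<noteq> w \<Longrightarrow> (u, w) \<notin> S \<Longrightarrow>
         meek_step S D (insert (a, b) D)"
| R4: "undirected S D a b \<Longrightarrow> undirected S D a u \<Longrightarrow> (u, w) \<in> D \<Longrightarrow> (w, b) \<in> D \<Longrightarrow>
         (a, w) \<in> S \<Longrightarrow> u \<noteq> b \<Longrightarrow> (u, b) \<notin> S \<Longrightarrow>
         meek_step S D (insert (a, b) D)"

text \<open>The order in which Meek rules are applied is left open, so PC-tree is a relation between test
  outcomes and output graphs.\<close>

definition pc_tree_output :: "nat \<Rightarrow> outcomes \<Rightarrow> pdag \<Rightarrow> bool" where
  "pc_tree_output d rej H \<longleftrightarrow> fst H = pc_skeleton d rej \<and>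
     (meek_step (fst H))\<^sup>*\<^sup>* (pc_v_arrows d rej) (snd H) \<and>
     (\<nexists>D. meek_step (fst H) (snd H) D)"

definition ber_outcomes :: "real \<Rightarrow> nat \<Rightarrow> (nat \<Rightarrow> nat \<Rightarrow> bool) \<Rightarrow> outcomes" where
  "ber_outcomes c n s j k l = (case l of
     None \<Rightarrow> psi_ber0 c n (\<lambda>i. (s i j, s i k))
   | Some h \<Rightarrow> psi_ber c n (\<lambda>i. (s i j, s i k, s i h)))"

definition is_pc_tree :: "nat \<Rightarrow> real \<Rightarrow> nat \<Rightarrow> ((nat \<Rightarrow> nat \<Rightarrow> bool) \<Rightarrow> pdag) \<Rightarrow> bool" where
  "is_pc_tree d c n Ghat \<longleftrightarrow> (\<forall>s. pc_tree_output d (ber_outcomes c n s) (Ghat s))"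

lemma meek_terminates:
  assumes "finite S"
  shows "\<exists>D'. (meek_step S)\<^sup>*\<^sup>* D D' \<and> (\<nexists>D''. meek_step S D' D'')"
proof (induction "card (S - D)" arbitrary: D rule: less_induct)
  case less
  show ?case
  proof (cases "\<exists>D1. meek_step S D D1")
    case True
    then obtain D1 where step: "meek_step S D D1" by blast
    then obtain e where e: "D1 = insert e D" "e \<in> S" "e \<notin> D"
      by cases (auto simp: undirected_def)
    have "card (S - D1) < card (S - D)"
      by (rule psubset_card_mono) (use e assms in auto)
    with less[of D1] step show ?thesis
      by (meson converse_rtranclp_into_rtranclp)
  qed blast
qed

lemma is_pc_tree_exists: "\<exists>Ghat. is_pc_tree d c n Ghat"
proof -
  have "\<exists>H. pc_tree_output d rej H" for rej
  proof -
    have "pc_skeleton d rej \<subseteq> {..<d} \<times> {..<d}"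
      by (auto simp: pc_skeleton_def)
    then have "finite (pc_skeleton d rej)"
      by (rule finite_subset) auto
    from meek_terminates[OF this, of "pc_v_arrows d rej"] show ?thesis
      by (auto simp: pc_tree_output_def)
  qed
  then show ?thesis
    unfolding is_pc_tree_def by (intro choice) blast
qed

text \<open>The parameter range: \<open>1\<close> is the largest value of the Bernoulli dependence measure, so for
  \<open>c > 1\<close> the only poly-forest in the class is the one without edges.\<close>

definition params :: "(nat \<times> real) set" where
  "params = {(d, c). 1 \<le> d \<and> 0 < c \<and> c \<le> 1}"

end

theory Submission
  imports Defs
begin

text \<open>Upper bounds: \<open>m_ber\<close> is Lipschitz in the mass function, so by Hoeffding's inequality and a union
  bound all plug-in statistics are simultaneously accurate to within \<open>c / 2\<close> once \<open>n\<close> is of order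
  $\log d / c^2$. Every test then decides correctly whenever the population value is \<open>0\<close> or at
  least \<open>c\<close>, and these decisions suffice: non-adjacent nodes of a poly-forest are separated by at most
  one node, and in a forest Meek's rule R1 alone recovers the CPDAG, rules R2 to R4 needing
  triangles.

  Lower bounds: fair coins against coins of which two agree with probability $(1 + c)/2$. The
  likelihood ratio of one sample has second moment $1 + c^2$, so by Cauchy-Schwarz the laws $P$ and
  $Q$ of $n$ samples satisfy $Q(A)^2 \le P(A)\, e^{nc^2}$ for every event $A$.\<close>

section \<open>Poly-forests and their CPDAGs\<close>

text \<open>Three obstacles shape the proof. The quotient \<open>p(x,z) p(y,z) / p(z)\<close> inside
  \<open>m_ber\<close> looks unstable at values \<open>z\<close> of small mass. Both marginals in
  its numerator are bounded by \<open>p(z)\<close>, which makes the Lipschitz constant independent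
  of the law, so no lower bound on cell masses enters. A conditional factor is 0 when its parent
  event is null, so summing out a variable leaves mass at most 1 and not exactly 1. Independence of
  nodes without a common ancestor is recovered by comparing total masses; independence given a node
  comes from cutting one edge, where a bare product form is enough. The CPDAG is defined through the
  d-separations of all equivalent DAGs, which the algorithm never sees. One direction shows that
  equivalent DAGs share skeleton and v-structures, so that Meek orientations hold in all of them.
  The other exhibits, for each edge left unoriented, an equivalent DAG with that edge reversed. The
  factor \<open>ln d\<close> in the lower bound comes from \<open>d - 1\<close> alternatives with
  disjoint recovery events: on average such an event has probability of order \<open>1/d\<close>
  under the uniform law.\<close>

lemma skeleton_sym: "(a, b) \<in> skeleton E \<longleftrightarrow> (b, a) \<in> skeleton E"
  by (auto simp: skeleton_def)

lemma v_structure_sym: "v_structure E k l j \<longleftrightarrow> v_structure E j l k"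
  using skeleton_sym[of k j E] by (auto simp: v_structure_def)

text \<open>Loops are cut out: if the new start already lies on the walk, the suffix from there is
  used. Distinctness matters because uniqueness in a poly-forest is only about simple paths.\<close>

lemma rtrancl_imp_distinct_walk:
  assumes "(a, b) \<in> R\<^sup>*"
  shows "\<exists>xs. xs \<noteq> [] \<and> hd xs = a \<and> last xs = b \<and> distinct xs \<and>
    successively (\<lambda>u v. (u, v) \<in> R) xs"
  using assms
proof (induction rule: converse_rtrancl_induct)
  case base
  show ?case by (rule exI[of _ "[b]"]) auto
next
  case (step a a')
  then obtain xs where xs: "xs \<noteq> []" "hd xs = a'" "last xs = b" "distinct xs"
    "successively (\<lambda>u v. (u, v) \<in> R) xs"
    by blast
  show ?case
  proof (cases "a \<in> set xs")
    case True
    then obtain ys zs where "xs = ys @ a # zs" by (meson split_list)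
    then show ?thesis
      using xs by (intro exI[of _ "a # zs"]) (auto simp: successively_append_iff)
  next
    case False
    then show ?thesis
      using xs step.hyps by (intro exI[of _ "a # xs"]) (auto simp: successively_Cons)
  qed
qed

lemma poly_forestsD:
  assumes "E \<in> poly_forests d"
  shows "E \<subseteq> {..<d} \<times> {..<d}" "acyclic E"
    "skel_path E a b xs \<Longrightarrow> skel_path E a b ys \<Longrightarrow> xs = ys"
    "is_dag d E"
  using assms unfolding poly_forests_def is_dag_def by blast+

lemma acyclic_antisym: "acyclic E \<Longrightarrow> (a, b) \<in> E \<Longrightarrow> (b, a) \<notin> E\<^sup>*"
  unfolding acyclic_def by (metis rtrancl_into_trancl2)

lemma poly_forests_asym:
  assumes "E \<in> poly_forests d" "(a, b) \<in> E"
  shows "(b, a) \<notin> E" "a \<noteq> b"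
  using acyclic_antisym[OF poly_forestsD(2)[OF assms(1)] assms(2)] by auto

lemma skeleton_irrefl: "E \<in> poly_forests d \<Longrightarrow> (a, b) \<in> skeleton E \<Longrightarrow> a \<noteq> b"
  using poly_forests_asym by (fastforce simp: skeleton_def)

lemma skeleton_less:
  assumes "E \<in> poly_forests d" "(a, b) \<in> skeleton E"
  shows "a < d" "b < d"
  using poly_forestsD(1)[OF assms(1)] assms(2) by (auto simp: skeleton_def)

lemma skel_path_edge:
  "E \<in> poly_forests d \<Longrightarrow> (a, b) \<in> skeleton E \<Longrightarrow> skel_path E a b [a, b]"
  using skeleton_irrefl[of E d a b] by (auto simp: skel_path_def)

lemma triangle_free:
  assumes E: "E \<in> poly_forests d" and "(a, b) \<in> skeleton E" "(b, c) \<in> skeleton E"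
  shows "(a, c) \<notin> skeleton E"
proof
  assume ac: "(a, c) \<in> skeleton E"
  have "a \<noteq> b" "b \<noteq> c" "a \<noteq> c" using assms ac skeleton_irrefl by blast+
  then have "skel_path E a c [a, b, c]" using assms(2,3) by (auto simp: skel_path_def)
  from poly_forestsD(3)[OF E this skel_path_edge[OF E ac]] show False by simp
qed

text \<open>In a forest two neighbours of one node are never adjacent, so every collider is a
  v-structure.\<close>

lemma v_structure_forest:
  assumes "E \<in> poly_forests d"
  shows "v_structure E k l j \<longleftrightarrow> (k, l) \<in> E \<and> (j, l) \<in> E \<and> k \<noteq> j"
  using triangle_free[OF assms, of k l j] by (auto simp: v_structure_def skeleton_def)

text \<open>A directed cycle through \<open>x \<rightarrow> y\<close> contains a simple path from
  \<open>y\<close> back to \<open>x\<close>. By uniqueness this path is the edge itself, which would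
  then be present in both directions. Hence reorienting edges one by one can never create a
  cycle.\<close>

lemma asym_forest_acyclic:
  assumes E: "E \<in> poly_forests d" and sk: "skeleton E' = skeleton E"
    and asym: "\<And>a b. (a, b) \<in> E' \<Longrightarrow> (b, a) \<notin> E'"
  shows "E' \<in> poly_forests d"
proof -
  have sp: "skel_path E' = skel_path E"
    by (intro ext) (simp add: skel_path_def sk)
  have "acyclic E'"
  proof (rule acyclicI, rule allI, rule notI)
    fix x assume "(x, x) \<in> E'\<^sup>+"
    then obtain y where y: "(x, y) \<in> E'" "(y, x) \<in> E'\<^sup>*"
      by (meson tranclD)
    from rtrancl_imp_distinct_walk[OF y(2)] obtain xs where xs: "xs \<noteq> []" "hd xs = y"
      "last xs = x" "distinct xs" "successively (\<lambda>u v. (u, v) \<in> E') xs"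
      by blast
    have "successively (\<lambda>u v. (u, v) \<in> skeleton E) xs"
      using xs(5) unfolding sk[symmetric] by (rule successively_mono) (auto simp: skeleton_def)
    then have "skel_path E y x xs" using xs by (auto simp: skel_path_def)
    moreover have "(y, x) \<in> skeleton E"
      using y(1) unfolding sk[symmetric] by (auto simp: skeleton_def)
    ultimately have "xs = [y, x]" using skel_path_edge[OF E] poly_forestsD(3)[OF E] by blast
    with xs(5) y(1) asym show False by auto
  qed
  moreover have "E' \<subseteq> {..<d} \<times> {..<d}"
    using skeleton_less[OF E] unfolding sk[symmetric] by (auto simp: skeleton_def)
  moreover have "xs = ys" if "skel_path E' a b xs" "skel_path E' a b ys" for a b xs ys
    using that unfolding sp by (rule poly_forestsD(3)[OF E])
  ultimately show ?thesis
    unfolding poly_forests_def is_dag_def by simp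
qed

section \<open>Markov equivalence of poly-forests: skeleton and v-structures\<close>

lemma adjacent_not_d_separated:
  assumes "is_dag d E" "(a, b) \<in> skeleton E"
  shows "\<not> d_separated E a b Z"
proof -
  have "a \<noteq> b" using assms by (auto simp: is_dag_def skeleton_def acyclic_def)
  then have "skel_path E a b [a, b]" using assms by (auto simp: skel_path_def)
  then show ?thesis by (auto simp: d_separated_def path_blocked_def)
qed

text \<open>There is at most one path to block. If the empty set fails to block it, no interior node
  is a collider, and the first interior node alone blocks it.\<close>

lemma nonadjacent_d_separated:
  assumes E: "E \<in> poly_forests d" and ab: "a \<noteq> b" "(a, b) \<notin> skeleton E"
  shows "\<exists>Z \<subseteq> {..<d} - {a, b}. d_separated E a b Z"
proof (cases "d_separated E a b {}")
  case True
  then show ?thesis by blast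
next
  case False
  then obtain xs where xs: "skel_path E a b xs" "\<not> path_blocked E {} xs"
    by (auto simp: d_separated_def)
  obtain u v ys where xs_eq: "xs = a # u # v # ys"
  proof -
    from xs(1) obtain xs1 where 1: "xs = a # xs1" by (cases xs) (auto simp: skel_path_def)
    with xs(1) ab(1) obtain u xs2 where 2: "xs1 = u # xs2"
      by (cases xs1) (auto simp: skel_path_def)
    with xs(1) ab(2) 1 obtain v ys where "xs2 = v # ys"
      by (cases xs2) (auto simp: skel_path_def)
    with 1 2 that show thesis by blast
  qed
  have "(a, u) \<in> skeleton E" using xs(1) xs_eq by (auto simp: skel_path_def)
  then have "u < d" using skeleton_less[OF E] by blast
  have "u \<noteq> a" "u \<noteq> b" using xs(1) xs_eq by (auto simp: skel_path_def split: if_splits)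
  \<comment> \<open>With \<open>Z = {}\<close> a collider blocks vacuously, so an unblocked path has
    none; index 1 is the position of \<open>u\<close>.\<close>
  have "\<not> ((a, u) \<in> E \<and> (v, u) \<in> E)"
    using xs(2) unfolding xs_eq path_blocked_def by (auto dest!: spec[of _ 1])
  then have "path_blocked E {u} xs"
    unfolding xs_eq path_blocked_def by (intro exI[of _ 1]) auto
  then have "d_separated E a b {u}"
    using poly_forestsD(3)[OF E xs(1)] by (auto simp: d_separated_def)
  with \<open>u < d\<close> \<open>u \<noteq> a\<close> \<open>u \<noteq> b\<close> show ?thesis by (intro exI[of _ "{u}"]) auto
qed

lemma skeleton_subset_poly_forest:
  assumes E: "E \<in> poly_forests d" and "is_dag d E'" and sk: "skeleton E' \<subseteq> skeleton E"
  shows "E' \<in> poly_forests d"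
proof -
  have "skel_path E a b xs" if "skel_path E' a b xs" for a b xs
    using that sk unfolding skel_path_def by (auto elim!: successively_mono)
  then show ?thesis using assms poly_forestsD(3)[OF E] unfolding poly_forests_def by blast
qed

lemma markov_equivalent_sym: "markov_equivalent d E E' \<Longrightarrow> markov_equivalent d E' E"
  by (auto simp: markov_equivalent_def)

lemma markov_equivalent_nonadjacent:
  assumes E: "E \<in> poly_forests d" and eq: "markov_equivalent d E E'"
  shows "skeleton E' \<subseteq> skeleton E"
proof (rule subrelI, rule ccontr)
  fix a b assume ab: "(a, b) \<in> skeleton E'" "(a, b) \<notin> skeleton E"
  have dag: "is_dag d E'" using eq by (auto simp: markov_equivalent_def)
  then have "a < d" "b < d" "a \<noteq> b"
    using ab(1) by (auto simp: is_dag_def skeleton_def acyclic_def)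
  with nonadjacent_d_separated[OF E _ ab(2)] obtain Z
    where "Z \<subseteq> {..<d} - {a, b}" "d_separated E a b Z" by blast
  then have "d_separated E' a b Z"
    using eq \<open>a < d\<close> \<open>b < d\<close> \<open>a \<noteq> b\<close> unfolding markov_equivalent_def by blast
  then show False using adjacent_not_d_separated[OF dag ab(1)] by blast
qed

text \<open>The first inclusion makes \<open>E'\<close> a poly-forest as well, and only then can the
  same argument be run with the roles exchanged.\<close>

lemma markov_equivalent_skeleton:
  assumes E: "E \<in> poly_forests d" and eq: "markov_equivalent d E E'"
  shows "E' \<in> poly_forests d" "skeleton E' = skeleton E"
proof -
  have sub: "skeleton E' \<subseteq> skeleton E" by (rule markov_equivalent_nonadjacent[OF assms])
  show E': "E' \<in> poly_forests d"
    using skeleton_subset_poly_forest[OF E _ sub] eq by (auto simp: markov_equivalent_def)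
  show "skeleton E' = skeleton E"
    using sub markov_equivalent_nonadjacent[OF E' markov_equivalent_sym[OF eq]] by blast
qed

text \<open>The path over \<open>l\<close> is the only one between \<open>k\<close> and
  \<open>j\<close>, and the empty set blocks it exactly at a collider. This expresses v-structures
  by d-separation and so makes them invariants of the equivalence class.\<close>

lemma d_separated_fork:
  assumes E: "E \<in> poly_forests d"
    and kl: "(k, l) \<in> skeleton E" "(j, l) \<in> skeleton E" "k \<noteq> j"
  shows "d_separated E k j {} \<longleftrightarrow> v_structure E k l j"
proof -
  have "skel_path E k j [k, l, j]"
    using kl skeleton_irrefl[OF E] skeleton_sym by (fastforce simp: skel_path_def)
  then have "d_separated E k j {} \<longleftrightarrow> path_blocked E {} [k, l, j]"
    using poly_forestsD(3)[OF E] unfolding d_separated_def by blast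
  also have "\<dots> \<longleftrightarrow> v_structure E k l j"
    using kl unfolding v_structure_forest[OF E] path_blocked_def
    by (auto simp: less_Suc_eq intro!: exI[of _ 1])
  finally show ?thesis .
qed

lemma markov_equivalent_v_structure:
  assumes E: "E \<in> poly_forests d" and eq: "markov_equivalent d E E'"
  shows "v_structure E' k l j \<longleftrightarrow> v_structure E k l j"
proof (cases "(k, l) \<in> skeleton E \<and> (j, l) \<in> skeleton E \<and> k \<noteq> j")
  case True
  note E' = markov_equivalent_skeleton[OF assms]
  have "k < d" "j < d" using True skeleton_less[OF E] by blast+
  then have "d_separated E k j {} = d_separated E' k j {}"
    using eq True unfolding markov_equivalent_def by blast
  then show ?thesis
    using d_separated_fork[OF E] d_separated_fork[OF E'(1)] E'(2) True by metis
next
  case False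
  then show ?thesis
    using markov_equivalent_skeleton(2)[OF assms] unfolding v_structure_def
    by (auto simp: skeleton_def)
qed

text \<open>Below a common arrow every edge is compelled, as reversing it would create a v-structure.\<close>

lemma descendants_compelled:
  assumes E: "E \<in> poly_forests d" and E': "E' \<in> poly_forests d" and sk: "skeleton E' = skeleton E"
    and vs: "\<And>k l j. v_structure E' k l j \<longleftrightarrow> v_structure E k l j"
    and kl: "(k, l) \<in> E" "(k, l) \<in> E'" and lz: "(l, z) \<in> E\<^sup>*"
  shows "(l, z) \<in> E'\<^sup>*"
proof -
  have "(l, z) \<in> E'\<^sup>* \<and> (\<exists>u. (u, z) \<in> E \<and> (u, z) \<in> E')"
    using lz
  proof (induction rule: rtrancl_induct)
    case base
    then show ?case using kl by blast
  next
    case (step z m)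
    then obtain u where u: "(u, z) \<in> E" "(u, z) \<in> E'" by blast
    have "u \<noteq> m" using poly_forests_asym[OF E u(1)] step.hyps by blast
    have "(z, m) \<in> skeleton E'" using step.hyps sk by (auto simp: skeleton_def)
    moreover have "(m, z) \<notin> E'"
    proof
      assume "(m, z) \<in> E'"
      then have "v_structure E' u z m" using u \<open>u \<noteq> m\<close> v_structure_forest[OF E'] by blast
      then have "(m, z) \<in> E" using vs by (auto simp: v_structure_def)
      then show False using poly_forests_asym[OF E] step.hyps by blast
    qed
    ultimately have "(z, m) \<in> E'" by (auto simp: skeleton_def)
    then show ?case using step by (meson rtrancl.rtrancl_into_rtrancl)
  qed
  then show ?thesis ..
qed

text \<open>Which interior nodes are colliders is decided by the v-structures. Whether a collider is
  opened by \<open>Z\<close> depends on its descendants, and these agree because an arrow into the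
  collider is common to both graphs.\<close>

lemma path_blocked_same_v_structures:
  assumes E: "E \<in> poly_forests d" and E': "E' \<in> poly_forests d" and sk: "skeleton E' = skeleton E"
    and vs: "\<And>k l j. v_structure E' k l j \<longleftrightarrow> v_structure E k l j"
    and xs: "skel_path E a b xs" and bl: "path_blocked E Z xs"
  shows "path_blocked E' Z xs"
proof -
  from bl obtain i where i: "0 < i" "i + 1 < length xs"
    and b: "if (xs ! (i - 1), xs ! i) \<in> E \<and> (xs ! (i + 1), xs ! i) \<in> E
      then \<forall>z\<in>Z. (xs ! i, z) \<notin> E\<^sup>* else xs ! i \<in> Z"
    unfolding path_blocked_def by blast
  have ne: "xs ! (i - 1) \<noteq> xs ! (i + 1)"
    using xs i by (auto simp: skel_path_def nth_eq_iff_index_eq)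
  have "((xs ! (i - 1), xs ! i) \<in> E \<and> (xs ! (i + 1), xs ! i) \<in> E) \<longleftrightarrow>
      ((xs ! (i - 1), xs ! i) \<in> E' \<and> (xs ! (i + 1), xs ! i) \<in> E')"
    using vs[of "xs ! (i - 1)" "xs ! i" "xs ! (i + 1)"] ne
    unfolding v_structure_forest[OF E] v_structure_forest[OF E'] by blast
  \<comment> \<open>\<open>descendants_compelled\<close> is used with the two graphs exchanged: a
    descendant in \<open>E'\<close> is one in \<open>E\<close>.\<close>
  moreover have "\<forall>z\<in>Z. (xs ! i, z) \<notin> E'\<^sup>*"
    if "(xs ! (i - 1), xs ! i) \<in> E" "(xs ! (i - 1), xs ! i) \<in> E'" "\<forall>z\<in>Z. (xs ! i, z) \<notin> E\<^sup>*"
    using descendants_compelled[OF E' E sk[symmetric] vs[symmetric] that(2,1)] that(3) by blast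
  ultimately show ?thesis
    using i b unfolding path_blocked_def by (intro exI[of _ i]) (auto split: if_splits)
qed

text \<open>The sufficiency half of the Verma-Pearl criterion; it certifies that a constructed
  reorientation is equivalent.\<close>

lemma markov_equivalentI:
  assumes E: "E \<in> poly_forests d" and sk: "skeleton E' = skeleton E"
    and asym: "\<And>a b. (a, b) \<in> E' \<Longrightarrow> (b, a) \<notin> E'"
    and vs: "\<And>k l j. v_structure E' k l j \<longleftrightarrow> v_structure E k l j"
  shows "markov_equivalent d E E'"
proof -
  have E': "E' \<in> poly_forests d" by (rule asym_forest_acyclic[OF E sk asym])
  have sp: "skel_path E' = skel_path E"
    by (intro ext) (simp add: skel_path_def sk)
  have "path_blocked E Z xs \<longleftrightarrow> path_blocked E' Z xs" if "skel_path E a b xs" for a b xs Z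
    using path_blocked_same_v_structures[OF E E' sk vs]
      path_blocked_same_v_structures[OF E' E sk[symmetric] vs[symmetric]] that sp by metis
  then have "d_separated E a b Z = d_separated E' a b Z" for a b Z
    unfolding d_separated_def sp by blast
  then show ?thesis
    using poly_forestsD(4)[OF E] poly_forestsD(4)[OF E'] by (simp add: markov_equivalent_def)
qed


section \<open>Meek's rules in a forest: soundness and completeness\<close>

text \<open>For R1, orienting \<open>b \<rightarrow> a\<close> instead would form a v-structure with
  \<open>u \<rightarrow> a\<close>, whose arrows are already in \<open>D\<close>, so the edge would
  not be undirected. The premises of the other rules contain a triangle. \<open>E'\<close> is
  arbitrary because the lemma is applied to every member of the equivalence class.\<close>

lemma meek_steps_sound:
  assumes E': "E' \<in> poly_forests d" and D: "D \<subseteq> E'" and vD: "\<And>k l j. v_structure E' k l j \<Longrightarrow> (k, l) \<in> D"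
    and steps: "(meek_step (skeleton E'))\<^sup>*\<^sup>* D D'"
  shows "D \<subseteq> D' \<and> D' \<subseteq> E'"
  using steps
proof (induction rule: rtranclp_induct)
  case base
  show ?case using D by simp
next
  case (step D1 D2)
  have sub: "(x, y) \<in> skeleton E'" if "(x, y) \<in> D1" for x y
    using that step.IH by (auto simp: skeleton_def)
  from step.hyps(2) step.IH show ?case
  proof cases
    case (R1 a b u)
    have "(b, a) \<notin> E'"
    proof
      assume "(b, a) \<in> E'"
      then have "v_structure E' b a u"
        using R1 step.IH v_structure_forest[OF E'] by blast
      then show False using vD step.IH R1 by (auto simp: undirected_def)
    qed
    then have "(a, b) \<in> E'" using R1 by (auto simp: undirected_def skeleton_def)
    then show ?thesis using R1 step.IH by auto
  next
    case (R2 a b u)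
    then show ?thesis using triangle_free[OF E', of a u b] sub by (auto simp: undirected_def)
  next
    case (R3 a b u w)
    then show ?thesis using triangle_free[OF E', of a u b] sub by (auto simp: undirected_def)
  next
    case (R4 a b u w)
    then show ?thesis using triangle_free[OF E', of a u w] sub by (auto simp: undirected_def)
  qed
qed

text \<open>An undirected edge \<open>a \<rightarrow> b\<close> of a Meek-closed graph can be reversed by reversing the whole
  chain of undirected ancestors of \<open>b\<close>: by rule R1 and the absence of v-structures, the root of
  this chain has no parent, and every other node of it only the preceding one.\<close>

lemma meek_closed_reversible:
  assumes E: "E \<in> poly_forests d" and D: "D \<subseteq> E"
    and vD: "\<And>k l j. v_structure E k l j \<Longrightarrow> (k, l) \<in> D"
    and closed: "\<nexists>D'. meek_step (skeleton E) D D'"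
    and ab: "(a, b) \<in> E" "(a, b) \<notin> D"
  shows "\<exists>E'. markov_equivalent d E E' \<and> (a, b) \<notin> E'"
proof -
  define U where "U = E - D"
  \<comment> \<open>\<open>R\<close> consists of the unoriented edges whose head reaches
    \<open>b\<close> along unoriented edges, among them \<open>(a, b)\<close>; exactly these are
    reversed.\<close>
  define R where "R = {(x, y). (x, y) \<in> U \<and> (y, b) \<in> U\<^sup>*}"
  define E' where "E' = (E - R) \<union> R\<inverse>"
  have asymE: "(y, x) \<notin> E" "x \<noteq> y" if "(x, y) \<in> E" for x y
    using poly_forests_asym[OF E that] by auto
  have RE: "R \<subseteq> E" "U \<subseteq> E" by (auto simp: R_def U_def)
  have one_parent: "w = x" if "(x, y) \<in> U" "(w, y) \<in> E" for x y w
  proof (rule ccontr)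
    assume "w \<noteq> x"
    then have "v_structure E x y w" using that v_structure_forest[OF E] by (auto simp: U_def)
    then show False using vD that by (auto simp: U_def)
  qed
  \<comment> \<open>An oriented arrow into the tail of an unoriented edge would trigger R1, there
    being no triangle.\<close>
  have U_up: "(w, x) \<in> U" if "(x, y) \<in> U" "(w, x) \<in> E" for x y w
  proof (rule ccontr)
    assume "(w, x) \<notin> U"
    then have "(w, x) \<in> D" using that by (auto simp: U_def)
    moreover have "undirected (skeleton E) D x y"
      using that(1) D asymE by (auto simp: U_def undirected_def skeleton_def)
    moreover have "w \<noteq> y" using that asymE by (auto simp: U_def)
    moreover have "(w, y) \<notin> skeleton E"
      using triangle_free[OF E, of w x y] that by (auto simp: U_def skeleton_def)
    ultimately show False using meek_step.R1 closed by blast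
  qed
  have "acyclic U" using acyclic_subset[OF poly_forestsD(2)[OF E] RE(2)] .
  \<comment> \<open>Two reversed edges meeting at \<open>l\<close> would create a new collider. By
    \<open>one_parent\<close> the ancestors of \<open>b\<close> in \<open>U\<close> form a chain, so
    one of \<open>k\<close>, \<open>j\<close> would reach the other; such a walk enters its end
    through the only parent \<open>l\<close> and closes a cycle.\<close>
  have one_child: False
    if "(l, k) \<in> R" "(l, j) \<in> R" "k \<noteq> j" for l k j
  proof -
    have no: False if kj: "(l, k) \<in> U" "(l, j) \<in> U" "k \<noteq> j" "(k, j) \<in> U\<^sup>*" for k j
    proof -
      from kj(3,4) obtain w where "(k, w) \<in> U\<^sup>*" "(w, j) \<in> U" by (meson rtranclE)
      with one_parent kj RE have "(k, l) \<in> U\<^sup>*" by blast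
      then show False using acyclic_antisym[OF \<open>acyclic U\<close>] kj(1) by blast
    qed
    have "single_valued (U\<inverse>)" using one_parent RE by (auto simp: single_valued_def)
    then have "(k, j) \<in> (U\<inverse>)\<^sup>* \<or> (j, k) \<in> (U\<inverse>)\<^sup>*"
      by (rule single_valued_confluent) (use that in \<open>auto simp: R_def rtrancl_converse\<close>)
    then show False using no that by (auto simp: R_def rtrancl_converse)
  qed
  \<comment> \<open>The other way to create a collider: a reversed edge meeting an unchanged arrow
    at \<open>l\<close>. But by \<open>U_up\<close> that arrow is itself unoriented and leads
    towards \<open>b\<close>, hence is reversed too.\<close>
  have mixed: False if "(l, k) \<in> R" "(j, l) \<in> E - R" for l k j
  proof -
    have "(j, l) \<in> U" using U_up that by (auto simp: R_def)
    moreover have "(l, b) \<in> U\<^sup>*"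
      using that by (auto simp: R_def intro: converse_rtrancl_into_rtrancl)
    ultimately show False using that by (auto simp: R_def)
  qed
  have sk: "skeleton E' = skeleton E" using RE by (auto simp: E'_def skeleton_def)
  have asym: "(y, x) \<notin> E'" if "(x, y) \<in> E'" for x y
    using that asymE RE unfolding E'_def by blast
  have E'pf: "E' \<in> poly_forests d" by (rule asym_forest_acyclic[OF E sk asym])
  have "v_structure E' k l j \<longleftrightarrow> v_structure E k l j" for k l j
  proof
    assume v: "v_structure E k l j"
    then have "(k, l) \<in> D" "(j, l) \<in> D" using vD v_structure_sym by blast+
    then have "(k, l) \<in> E'" "(j, l) \<in> E'" using D by (auto simp: E'_def R_def U_def)
    with v show "v_structure E' k l j" by (auto simp: v_structure_def sk)
  next
    assume v: "v_structure E' k l j"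
    then have "(k, l) \<in> E'" "(j, l) \<in> E'" "k \<noteq> j" by (auto simp: v_structure_def)
    then have "(k, l) \<in> E" "(j, l) \<in> E"
      using one_child mixed unfolding E'_def by blast+
    with v show "v_structure E k l j" by (auto simp: v_structure_def sk)
  qed
  then have "markov_equivalent d E E'" by (intro markov_equivalentI[OF E sk asym])
  moreover have "(a, b) \<notin> E'" using ab asymE RE by (auto simp: E'_def R_def U_def)
  ultimately show ?thesis by blast
qed

text \<open>A non-adjacent pair is only required to be accepted at some conditioning node: at others
  the population value may lie strictly between 0 and the faithfulness level, where the test outcome
  is arbitrary. Orientation consults only the outcome at the common neighbour.\<close>

lemma pc_tree_output_correct:
  fixes rej :: outcomes
  assumes E: "E \<in> poly_forests d"
    and adj: "\<And>j k l. (j, k) \<in> skeleton E \<Longrightarrow> l \<in> cond_nodes d j k \<Longrightarrow>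
      rej (min j k) (max j k) l"
    and vst: "\<And>k l j. v_structure E k l j \<Longrightarrow> rej (min k j) (max k j) (Some l)"
    and nonadj: "\<And>j k. j < d \<Longrightarrow> k < d \<Longrightarrow> j \<noteq> k \<Longrightarrow> (j, k) \<notin> skeleton E \<Longrightarrow>
      \<exists>l\<in>cond_nodes d j k. \<not> rej (min j k) (max j k) l"
    and fork: "\<And>j l k. (j, l) \<in> skeleton E \<Longrightarrow> (k, l) \<in> skeleton E \<Longrightarrow> j \<noteq> k \<Longrightarrow>
      \<not> v_structure E j l k \<Longrightarrow> \<not> rej (min j k) (max j k) (Some l)"
    and out: "pc_tree_output d rej H"
  shows "H = cpdag d E"
proof -
  have skel: "pc_skeleton d rej = skeleton E"
  proof (rule set_eqI, clarify)
    fix j k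
    show "(j, k) \<in> pc_skeleton d rej \<longleftrightarrow> (j, k) \<in> skeleton E"
      using adj[of j k] nonadj[of j k] skeleton_less[OF E, of j k] skeleton_irrefl[OF E, of j k]
      by (auto simp: pc_skeleton_def accepting_def)
  qed
  have arrows: "(j, l) \<in> pc_v_arrows d rej \<longleftrightarrow> (\<exists>k. v_structure E j l k)" for j l
  proof
    assume "(j, l) \<in> pc_v_arrows d rej"
    then obtain k where k: "j \<noteq> k" "(j, l) \<in> skeleton E" "(k, l) \<in> skeleton E"
      "Some l \<notin> accepting d rej j k"
      by (auto simp: pc_v_arrows_def skel)
    moreover have "Some l \<in> cond_nodes d j k"
      using skeleton_irrefl[OF E k(2)] skeleton_irrefl[OF E k(3)] skeleton_less[OF E k(2)]
      by (auto simp: cond_nodes_def)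
    ultimately show "\<exists>k. v_structure E j l k" using fork by (auto simp: accepting_def)
  next
    assume "\<exists>k. v_structure E j l k"
    then obtain k where k: "v_structure E j l k" by blast
    then show "(j, l) \<in> pc_v_arrows d rej"
      using vst[OF k] by (auto simp: pc_v_arrows_def skel accepting_def v_structure_def skeleton_def)
  qed
  let ?D = "snd H"
  have steps: "(meek_step (skeleton E))\<^sup>*\<^sup>* (pc_v_arrows d rej) ?D"
    and closed: "\<nexists>D'. meek_step (skeleton E) ?D D'" and fst: "fst H = skeleton E"
    using out by (auto simp: pc_tree_output_def skel)
  \<comment> \<open>Soundness in every equivalent graph, not just in \<open>E\<close>, is what
    places the arrows in the CPDAG.\<close>
  have sound: "pc_v_arrows d rej \<subseteq> ?D \<and> ?D \<subseteq> E'" if "markov_equivalent d E E'" for E'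
  proof (rule meek_steps_sound)
    show "E' \<in> poly_forests d" using markov_equivalent_skeleton[OF E that] by blast
    show "pc_v_arrows d rej \<subseteq> E'"
      using arrows markov_equivalent_v_structure[OF E that]
      by (auto simp: v_structure_def) metis
    show "(k, l) \<in> pc_v_arrows d rej" if "v_structure E' k l j" for k l j
      using arrows markov_equivalent_v_structure[OF E \<open>markov_equivalent d E E'\<close>] that by blast
    show "(meek_step (skeleton E'))\<^sup>*\<^sup>* (pc_v_arrows d rej) ?D"
      using steps markov_equivalent_skeleton[OF E that] by simp
  qed
  have "markov_equivalent d E E"
    using poly_forestsD(4)[OF E] by (auto simp: markov_equivalent_def)
  from sound[OF this] have DE: "pc_v_arrows d rej \<subseteq> ?D" "?D \<subseteq> E" by auto
  have "?D = {e \<in> E. \<forall>E'. markov_equivalent d E E' \<longrightarrow> e \<in> E'}"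
  proof (intro equalityI subsetI)
    fix e assume "e \<in> ?D"
    then show "e \<in> {e \<in> E. \<forall>E'. markov_equivalent d E E' \<longrightarrow> e \<in> E'}"
      using sound DE by blast
  next
    fix e assume e: "e \<in> {e \<in> E. \<forall>E'. markov_equivalent d E E' \<longrightarrow> e \<in> E'}"
    obtain a b where [simp]: "e = (a, b)" by force
    show "e \<in> ?D"
    proof (rule ccontr)
      assume "e \<notin> ?D"
      then have "\<exists>E'. markov_equivalent d E E' \<and> (a, b) \<notin> E'"
        using e by (intro meek_closed_reversible[OF E DE(2) _ closed]) (use arrows DE in auto)
      then show False using e by auto
    qed
  qed
  with fst show ?thesis by (simp add: cpdag_def prod_eq_iff)
qed

section \<open>Conditional independence in poly-forests\<close>

lemma sum_PiE_insert:
  fixes f :: "('a \<Rightarrow> 'b::finite) \<Rightarrow> 'c::comm_monoid_add"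
  assumes "s \<notin> A"
  shows "(\<Sum>x\<in>insert s A \<rightarrow>\<^sub>E UNIV. f x) = (\<Sum>u\<in>A \<rightarrow>\<^sub>E UNIV. \<Sum>b\<in>UNIV. f (u(s := b)))"
proof -
  have "(\<Sum>x\<in>insert s A \<rightarrow>\<^sub>E UNIV. f x) =
      (\<Sum>(b, u)\<in>UNIV \<times> (A \<rightarrow>\<^sub>E UNIV). f (u(s := b)))"
    by (rule sum.reindex_bij_witness[of _ "\<lambda>(b, u). u(s := b)" "\<lambda>x. (x s, x(s := undefined))"])
      (use assms in \<open>auto simp: PiE_def extensional_def fun_eq_iff\<close>)
  also have "\<dots> = (\<Sum>b\<in>UNIV. \<Sum>u\<in>A \<rightarrow>\<^sub>E UNIV. f (u(s := b)))"
    by (rule sum.cartesian_product[symmetric])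
  finally show ?thesis by (subst sum.swap)
qed

lemma sum_PiE_Un:
  fixes f :: "('a \<Rightarrow> 'b::finite) \<Rightarrow> 'c::comm_monoid_add"
  assumes "A \<inter> B = {}"
  shows "(\<Sum>x\<in>A \<union> B \<rightarrow>\<^sub>E UNIV. f x) =
    (\<Sum>u\<in>A \<rightarrow>\<^sub>E UNIV. \<Sum>w\<in>B \<rightarrow>\<^sub>E UNIV. f (override_on u w B))"
proof -
  have "(\<Sum>x\<in>A \<union> B \<rightarrow>\<^sub>E UNIV. f x) =
      (\<Sum>(u, w)\<in>(A \<rightarrow>\<^sub>E UNIV) \<times> (B \<rightarrow>\<^sub>E UNIV). f (override_on u w B))"
    by (rule sum.reindex_bij_witness[of _ "\<lambda>(u, w). override_on u w B"
          "\<lambda>x. (restrict x A, restrict x B)"])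
      (use assms in \<open>auto simp: override_on_def PiE_def extensional_def restrict_def fun_eq_iff
         intro!: arg_cong[of _ _ f]\<close>)
  then show ?thesis by (simp add: sum.cartesian_product)
qed

definition cond_factor :: "(nat \<Rightarrow> bool) pmf \<Rightarrow> (nat \<times> nat) set \<Rightarrow> nat \<Rightarrow> (nat \<Rightarrow> bool) \<Rightarrow> real" where
  "cond_factor p E k x = measure_pmf.prob p (cylinder (insert k (parents E k)) x)
     / measure_pmf.prob p (cylinder (parents E k) x)"

lemma cylinder_cong: "(\<And>j. j \<in> A \<Longrightarrow> x j = y j) \<Longrightarrow> cylinder A x = cylinder A y"
  by (auto simp: cylinder_def)

lemma cond_factor_cong:
  assumes "\<And>j. j \<in> insert k (parents E k) \<Longrightarrow> x j = y j"
  shows "cond_factor p E k x = cond_factor p E k y"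
  using cylinder_cong[of "insert k (parents E k)" x y] cylinder_cong[of "parents E k" x y] assms
  by (simp add: cond_factor_def)

lemma cond_factor_nonneg: "cond_factor p E k x \<ge> 0"
  by (simp add: cond_factor_def)

text \<open>The sum is 1 unless the parent cylinder is null, where division by zero makes all
  factors 0.\<close>

lemma sum_cond_factor_le_1:
  assumes "k \<notin> parents E k"
  shows "(\<Sum>b\<in>UNIV. cond_factor p E k (x(k := b))) \<le> 1"
proof -
  let ?P = "cylinder (parents E k) x"
  have pa: "cylinder (parents E k) (x(k := b)) = ?P" for b
    using assms by (intro cylinder_cong) auto
  have "(\<Sum>b\<in>UNIV. measure_pmf.prob p (cylinder (insert k (parents E k)) (x(k := b)))) =
      measure_pmf.prob p (\<Union>b\<in>UNIV. cylinder (insert k (parents E k)) (x(k := b)))"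
    by (rule measure_pmf.finite_measure_finite_Union[symmetric])
      (auto simp: disjoint_family_on_def cylinder_def)
  also have "(\<Union>b\<in>UNIV. cylinder (insert k (parents E k)) (x(k := b))) = ?P"
    using assms by (auto simp: cylinder_def)
  finally have "(\<Sum>b\<in>UNIV. cond_factor p E k (x(k := b))) =
      measure_pmf.prob p ?P / measure_pmf.prob p ?P"
    by (simp only: cond_factor_def pa flip: sum_divide_distrib)
  then show ?thesis by simp
qed

text \<open>Variables are summed out from a sink of \<open>B\<close>, which occurs in no factor of
  \<open>B\<close> but its own. The coordinates outside \<open>B\<close> stay frozen at
  \<open>x\<close>.\<close>

lemma sum_prod_cond_factor_le_1:
  assumes "finite B" "acyclic E"
  shows "(\<Sum>y\<in>B \<rightarrow>\<^sub>E UNIV. \<Prod>k\<in>B. cond_factor p E k (override_on x y B)) \<le> 1"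
  using assms(1)
proof (induction B arbitrary: x rule: finite_psubset_induct)
  case (psubset B)
  show ?case
  proof (cases "B = {}")
    case True
    then show ?thesis by simp
  next
    case False
    \<comment> \<open>A minimal element for the converse relation is a sink within
      \<open>B\<close>.\<close>
    have "wf ((E \<inter> B \<times> B)\<inverse>)"
      using psubset.hyps assms(2)
      by (intro finite_acyclic_wf_converse) (auto intro: acyclic_subset)
    moreover obtain x0 where "x0 \<in> B" using False by blast
    ultimately obtain s where s: "s \<in> B" "\<And>v. v \<in> B \<Longrightarrow> (s, v) \<notin> E"
      by (rule wfE_min) blast
    define A where "A = B - {s}"
    have B: "B = insert s A" "s \<notin> A" "A \<subset> B" "finite A"
      using s psubset.hyps by (auto simp: A_def)
    let ?c = "cond_factor p E"
    have ss: "s \<notin> parents E s" using s by (auto simp: parents_def)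
    have "(\<Sum>y\<in>B \<rightarrow>\<^sub>E UNIV. \<Prod>k\<in>B. ?c k (override_on x y B)) =
        (\<Sum>u\<in>A \<rightarrow>\<^sub>E UNIV. \<Sum>b\<in>UNIV. \<Prod>k\<in>B. ?c k (override_on x (u(s := b)) B))"
      unfolding B(1) by (rule sum_PiE_insert[OF B(2)])
    also have "\<dots> = (\<Sum>u\<in>A \<rightarrow>\<^sub>E UNIV. \<Sum>b\<in>UNIV.
        ?c s ((override_on x u A)(s := b)) * (\<Prod>k\<in>A. ?c k (override_on x u A)))"
    proof (intro sum.cong refl)
      fix u :: "nat \<Rightarrow> bool" and b
      have "(\<Prod>k\<in>A. ?c k (override_on x (u(s := b)) B)) = (\<Prod>k\<in>A. ?c k (override_on x u A))"
        using s B by (intro prod.cong cond_factor_cong refl) (auto simp: override_on_def parents_def)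
      moreover have "override_on x (u(s := b)) B = (override_on x u A)(s := b)"
        using B by (auto simp: override_on_def fun_eq_iff)
      ultimately show "(\<Prod>k\<in>B. ?c k (override_on x (u(s := b)) B)) =
          ?c s ((override_on x u A)(s := b)) * (\<Prod>k\<in>A. ?c k (override_on x u A))"
        using B by simp
    qed
    also have "\<dots> = (\<Sum>u\<in>A \<rightarrow>\<^sub>E UNIV. (\<Sum>b\<in>UNIV. ?c s ((override_on x u A)(s := b))) *
        (\<Prod>k\<in>A. ?c k (override_on x u A)))"
      by (simp only: sum_distrib_right)
    also have "\<dots> \<le> (\<Sum>u\<in>A \<rightarrow>\<^sub>E UNIV. 1 * (\<Prod>k\<in>A. ?c k (override_on x u A)))"
      by (intro sum_mono mult_right_mono sum_cond_factor_le_1 ss prod_nonneg)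
        (auto simp: cond_factor_nonneg)
    also have "\<dots> \<le> 1" using psubset.IH[OF B(3)] by simp
    finally show ?thesis .
  qed
qed

lemma pmf_map_eq_sum:
  assumes "finite S" "set_pmf p \<subseteq> S"
  shows "pmf (map_pmf h p) y = (\<Sum>x\<in>S. of_bool (h x = y) * pmf p x)"
proof -
  have "pmf (map_pmf h p) y = measure_pmf.prob p (h -` {y} \<inter> S)"
    unfolding pmf_map using assms(2)
    by (intro measure_pmf.finite_measure_eq_AE) (auto simp: AE_measure_pmf_iff)
  also have "\<dots> = (\<Sum>x\<in>h -` {y} \<inter> S. pmf p x)"
    using assms(1) by (intro measure_measure_pmf_finite) auto
  also have "\<dots> = (\<Sum>x\<in>S. of_bool (h x = y) * pmf p x)"
    using assms(1) by (intro sum.mono_neutral_cong_left) auto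
  finally show ?thesis .
qed

lemma pmf_map_markov:
  assumes "set_pmf p \<subseteq> {..<d} \<rightarrow>\<^sub>E UNIV" "markov d p E"
  shows "pmf (map_pmf h p) y =
    (\<Sum>x\<in>{..<d} \<rightarrow>\<^sub>E UNIV. of_bool (h x = y) * (\<Prod>k<d. cond_factor p E k x))"
proof -
  have "finite ({..<d} \<rightarrow>\<^sub>E (UNIV :: bool set))" by (intro finite_PiE) auto
  then show ?thesis
    using assms unfolding markov_def cond_factor_def by (simp add: pmf_map_eq_sum)
qed

text \<open>No normalization of \<open>F\<close> and \<open>G\<close> is involved: the missing
  constants cancel between the two marginals and \<open>mZ\<close>.\<close>

lemma m_ber_eq_0:
  assumes "\<And>x y z. q (x, y, z) = F x z * G y z"
  shows "m_ber q = 0"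
proof -
  have "mZ q z * \<bar>q (x, y, z) / mZ q z - (mXZ q x z / mZ q z) * (mYZ q y z / mZ q z)\<bar> = 0"
    for x y z
  proof (cases "mZ q z = 0")
    case False
    have Z: "mZ q z = (\<Sum>x\<in>UNIV. F x z) * (\<Sum>y\<in>UNIV. G y z)"
      by (simp add: mZ_def assms sum_product)
    have "mXZ q x z = F x z * (\<Sum>y\<in>UNIV. G y z)" "mYZ q y z = (\<Sum>x\<in>UNIV. F x z) * G y z"
      by (simp_all add: mXZ_def mYZ_def assms sum_distrib_left sum_distrib_right)
    then show ?thesis using False by (simp add: assms Z)
  qed simp
  then show ?thesis
    unfolding m_ber_def sum_distrib_left by (intro sum.neutral ballI)
qed

text \<open>\<open>m_ber0\<close> does not divide by the total mass, so here the normalization has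
  to be assumed.\<close>

lemma m_ber0_eq_0:
  assumes "\<And>x y. q (x, y) = F x * G y" and "(\<Sum>x\<in>UNIV. \<Sum>y\<in>UNIV. q (x, y)) = 1"
  shows "m_ber0 q = 0"
proof -
  have 1: "(\<Sum>x\<in>UNIV. F x) * (\<Sum>y\<in>UNIV. G y) = 1"
    using assms(2) by (simp add: assms(1) sum_product)
  have "(\<Sum>y'\<in>UNIV. q (x, y')) * (\<Sum>x'\<in>UNIV. q (x', y)) = F x * G y *
      ((\<Sum>x\<in>UNIV. F x) * (\<Sum>y\<in>UNIV. G y))" for x y
    by (simp add: assms(1) flip: sum_distrib_left sum_distrib_right)
  then show ?thesis by (simp add: m_ber0_def 1 assms(1))
qed

text \<open>The factorization gives \<open>P(X\<^sub>j = a, X\<^sub>k = b) \<le> F a * G b\<close> with \<open>F\<close> and \<open>G\<close> of total mass at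
  most \<open>1\<close>; as the left-hand side has total mass \<open>1\<close>, equality holds throughout.\<close>

lemma disjoint_ancestors_m_ber0:
  assumes supp: "set_pmf p \<subseteq> {..<d} \<rightarrow>\<^sub>E UNIV" and mk: "markov d p E" and acyc: "acyclic E"
    and A: "A1 \<subseteq> {..<d}" "A2 \<subseteq> {..<d}" "A1 \<inter> A2 = {}"
    and closed: "\<And>v. v \<in> A1 \<Longrightarrow> parents E v \<subseteq> A1" "\<And>v. v \<in> A2 \<Longrightarrow> parents E v \<subseteq> A2"
    and jk: "j \<in> A1" "k \<in> A2"
  shows "m_ber0 (pmf (map_pmf (\<lambda>x. (x j, x k)) p)) = 0"
proof -
  define q where "q = pmf (map_pmf (\<lambda>x. (x j, x k)) p)"
  let ?c = "cond_factor p E"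
  define F where "F A i a = (\<Sum>u\<in>A \<rightarrow>\<^sub>E UNIV. of_bool (u i = a) * (\<Prod>v\<in>A. ?c v u))"
    for A i and a :: bool
  \<comment> \<open>Nodes outside both ancestral sets. They occur in no factor of \<open>A1\<close>
    or \<open>A2\<close>, and summing them out yields a factor of at most 1, whence the inequality
    in \<open>q_le\<close>.\<close>
  define R where "R = {..<d} - (A1 \<union> A2)"
  have fin: "finite A1" "finite A2" "finite R" using A by (auto simp: R_def intro: finite_subset)
  have V: "{..<d} = A1 \<union> A2 \<union> R" "(A1 \<union> A2) \<inter> R = {}" using A by (auto simp: R_def)
  have F_nonneg: "F A i a \<ge> 0" for A i a
    unfolding F_def by (intro sum_nonneg mult_nonneg_nonneg prod_nonneg) (auto simp: cond_factor_nonneg)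
  have F_sum: "F A i True + F A i False \<le> 1" if "finite A" "\<And>v. v \<in> A \<Longrightarrow> parents E v \<subseteq> A" for A i
  proof -
    have "F A i True + F A i False = (\<Sum>u\<in>A \<rightarrow>\<^sub>E UNIV. \<Prod>v\<in>A. ?c v u)"
      unfolding F_def sum.distrib[symmetric] by (intro sum.cong) auto
    also have "\<dots> = (\<Sum>u\<in>A \<rightarrow>\<^sub>E UNIV. \<Prod>v\<in>A. ?c v (override_on undefined u A))"
      using that(2) by (intro sum.cong prod.cong cond_factor_cong refl) (auto simp: override_on_def)
    also have "\<dots> \<le> 1" by (rule sum_prod_cond_factor_le_1[OF that(1) acyc])
    finally show ?thesis .
  qed
  have q_le: "q (a, b) \<le> F A1 j a * F A2 k b" for a b
  proof -
    have "q (a, b) = (\<Sum>x\<in>A1 \<union> A2 \<union> R \<rightarrow>\<^sub>E UNIV.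
        of_bool ((x j, x k) = (a, b)) * (\<Prod>v\<in>A1 \<union> A2 \<union> R. ?c v x))"
      unfolding q_def pmf_map_markov[OF supp mk] V(1)[symmetric] ..
    also have "\<dots> = (\<Sum>u\<in>A1 \<rightarrow>\<^sub>E UNIV. \<Sum>w\<in>A2 \<rightarrow>\<^sub>E UNIV. \<Sum>r\<in>R \<rightarrow>\<^sub>E UNIV.
        of_bool (u j = a) * (\<Prod>v\<in>A1. ?c v u) * (of_bool (w k = b) * (\<Prod>v\<in>A2. ?c v w)) *
        (\<Prod>v\<in>R. ?c v (override_on (override_on u w A2) r R)))"
      unfolding sum_PiE_Un[OF V(2)] sum_PiE_Un[OF A(3)]
    proof (intro sum.cong refl)
      fix u w r :: "nat \<Rightarrow> bool"
      let ?x = "override_on (override_on u w A2) r R"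
      have "(\<Prod>v\<in>A1. ?c v ?x) = (\<Prod>v\<in>A1. ?c v u)"
        by (intro prod.cong refl cond_factor_cong)
          (use A V(2) closed(1) in \<open>auto simp: override_on_def subset_iff disjoint_iff\<close>)
      moreover have "(\<Prod>v\<in>A2. ?c v ?x) = (\<Prod>v\<in>A2. ?c v w)"
        by (intro prod.cong refl cond_factor_cong)
          (use A V(2) closed(2) in \<open>auto simp: override_on_def subset_iff disjoint_iff\<close>)
      moreover have "?x j = u j" "?x k = w k"
        using jk A V(2) by (auto simp: override_on_def)
      moreover have "(\<Prod>v\<in>A1 \<union> A2 \<union> R. ?c v ?x) =
          (\<Prod>v\<in>A1. ?c v ?x) * (\<Prod>v\<in>A2. ?c v ?x) * (\<Prod>v\<in>R. ?c v ?x)"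
        using fin A(3) V(2) by (simp add: prod.union_disjoint)
      ultimately show "of_bool ((?x j, ?x k) = (a, b)) * (\<Prod>v\<in>A1 \<union> A2 \<union> R. ?c v ?x) =
        of_bool (u j = a) * (\<Prod>v\<in>A1. ?c v u) * (of_bool (w k = b) * (\<Prod>v\<in>A2. ?c v w)) *
        (\<Prod>v\<in>R. ?c v ?x)"
        by simp
    qed
    also have "\<dots> = (\<Sum>u\<in>A1 \<rightarrow>\<^sub>E UNIV. \<Sum>w\<in>A2 \<rightarrow>\<^sub>E UNIV.
        of_bool (u j = a) * (\<Prod>v\<in>A1. ?c v u) * (of_bool (w k = b) * (\<Prod>v\<in>A2. ?c v w)) *
        (\<Sum>r\<in>R \<rightarrow>\<^sub>E UNIV. \<Prod>v\<in>R. ?c v (override_on (override_on u w A2) r R)))"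
      by (simp only: sum_distrib_left)
    also have "\<dots> \<le> (\<Sum>u\<in>A1 \<rightarrow>\<^sub>E UNIV. \<Sum>w\<in>A2 \<rightarrow>\<^sub>E UNIV.
        of_bool (u j = a) * (\<Prod>v\<in>A1. ?c v u) * (of_bool (w k = b) * (\<Prod>v\<in>A2. ?c v w)) * 1)"
      by (intro sum_mono mult_left_mono sum_prod_cond_factor_le_1 fin acyc mult_nonneg_nonneg
          prod_nonneg) (auto simp: cond_factor_nonneg)
    also have "\<dots> = F A1 j a * F A2 k b"
      unfolding F_def sum_product by simp
    finally show ?thesis .
  qed
  have q_sum: "(\<Sum>v\<in>UNIV. q v) = 1"
    unfolding q_def by (rule sum_pmf_eq_1) auto
  then have q1: "(\<Sum>x\<in>UNIV. \<Sum>y\<in>UNIV. q (x, y)) = 1"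
    by (simp add: sum.cartesian_product flip: UNIV_Times_UNIV)
  have "(F A1 j True + F A1 j False) * (F A2 k True + F A2 k False) \<le> 1 * 1"
    using fin closed by (intro mult_mono F_sum add_nonneg_nonneg F_nonneg) auto
  then have "F A1 j True * F A2 k True + F A1 j True * F A2 k False
      + F A1 j False * F A2 k True + F A1 j False * F A2 k False \<le> 1"
    by (simp add: algebra_simps)
  with q1 q_le[of True True] q_le[of True False] q_le[of False True] q_le[of False False]
  have "q (a, b) = F A1 j a * F A2 k b" for a b
    by (cases a; cases b) (auto simp: UNIV_bool)
  then show ?thesis using m_ber0_eq_0[OF _ q1] unfolding q_def by blast
qed

section \<open>Separation by a single node\<close>

text \<open>A connection avoiding the edge would be a second path between its ends.\<close>

lemma edge_cut:
  assumes E: "E \<in> poly_forests d" and lk: "(l, k) \<in> E"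
  shows "(k, l) \<notin> (skeleton (E - {(l, k)}))\<^sup>*"
proof
  assume "(k, l) \<in> (skeleton (E - {(l, k)}))\<^sup>*"
  from rtrancl_imp_distinct_walk[OF this] obtain xs where xs: "xs \<noteq> []" "hd xs = k" "last xs = l"
    "distinct xs" "successively (\<lambda>u v. (u, v) \<in> skeleton (E - {(l, k)})) xs"
    by blast
  have "successively (\<lambda>u v. (u, v) \<in> skeleton E) xs"
    using xs(5) by (rule successively_mono) (auto simp: skeleton_def)
  then have "skel_path E k l xs" using xs by (auto simp: skel_path_def)
  moreover have "(k, l) \<in> skeleton E" using lk by (auto simp: skeleton_def)
  ultimately have "xs = [k, l]" using skel_path_edge[OF E] poly_forestsD(3)[OF E] by blast
  with xs(5) lk poly_forests_asym[OF E lk] show False by (auto simp: skeleton_def)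
qed

text \<open>Cutting the edge \<open>l \<rightarrow> k\<close> splits the factorization into a function of the coordinates
  outside the component \<open>B\<close> of \<open>k\<close> and a function of those in \<open>B\<close> and of \<open>l\<close>.\<close>

lemma edge_cut_m_ber:
  assumes supp: "set_pmf p \<subseteq> {..<d} \<rightarrow>\<^sub>E UNIV" and mk: "markov d p E"
    and E: "E \<in> poly_forests d" and lk: "(l, k) \<in> E"
    and jl: "(j, l) \<in> (skeleton (E - {(l, k)}))\<^sup>*"
  shows "m_ber (pmf (map_pmf (\<lambda>x. (x j, x k, x l)) p)) = 0"
proof -
  let ?c = "cond_factor p E"
  define S where "S = skeleton (E - {(l, k)})"
  define B where "B = {v. (k, v) \<in> S\<^sup>*}"
  define A where "A = {..<d} - B"
  have S_sym: "(u, v) \<in> S \<Longrightarrow> (v, u) \<in> S" for u v by (auto simp: S_def skeleton_def)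
  then have S_rsym: "(u, v) \<in> S\<^sup>* \<Longrightarrow> (v, u) \<in> S\<^sup>*" for u v
    by (metis symE symI sym_rtrancl)
  have "k < d" "l < d" using lk poly_forestsD(1)[OF E] by auto
  have BV: "B \<subseteq> {..<d}"
  proof
    fix v assume "v \<in> B"
    then have "(k, v) \<in> S\<^sup>*" by (simp add: B_def)
    then show "v \<in> {..<d}"
      by (induction rule: rtrancl_induct)
        (use \<open>k < d\<close> poly_forestsD(1)[OF E] in \<open>auto simp: S_def skeleton_def\<close>)
  qed
  have kB: "k \<in> B" by (simp add: B_def)
  have lA: "l \<notin> B" using edge_cut[OF E lk] by (simp add: B_def S_def)
  have jA: "j \<notin> B" using jl lA unfolding B_def S_def by (auto intro: rtrancl_trans)
  \<comment> \<open>The cut edge is the only one crossing between \<open>B\<close> and its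
    complement, and its head \<open>k\<close> lies in \<open>B\<close>. So \<open>l\<close> is the
    only outside coordinate on which factors in \<open>B\<close> depend, and factors outside do not
    see \<open>B\<close>.\<close>
  have paB: "w \<in> B \<or> w = l" if "v \<in> B" "(w, v) \<in> E" for v w
    using that S_sym[of w v] by (auto simp: B_def S_def skeleton_def intro: rtrancl_into_rtrancl)
  have paA: "w \<notin> B" if "v \<notin> B" "(w, v) \<in> E" for v w
    using that kB by (auto simp: B_def S_def skeleton_def intro: rtrancl_into_rtrancl)
  have V: "{..<d} = A \<union> B" "A \<inter> B = {}" using BV by (auto simp: A_def)
  have fin: "finite A" "finite B" using BV by (auto simp: A_def intro: finite_subset)
  define F where "F a z = (\<Sum>u\<in>A \<rightarrow>\<^sub>E UNIV. of_bool (u j = a \<and> u l = z) * (\<Prod>v\<in>A. ?c v u))"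
    for a z
  \<comment> \<open>The node \<open>l\<close> lies outside \<open>B\<close>, so its value is passed
    in explicitly by \<open>w(l := z)\<close>.\<close>
  define G where "G b z = (\<Sum>w\<in>B \<rightarrow>\<^sub>E UNIV. of_bool (w k = b) * (\<Prod>v\<in>B. ?c v (w(l := z))))"
    for b z
  have "pmf (map_pmf (\<lambda>x. (x j, x k, x l)) p) (a, b, z) = F a z * G b z" for a b z
  proof -
    have "pmf (map_pmf (\<lambda>x. (x j, x k, x l)) p) (a, b, z) = (\<Sum>x\<in>A \<union> B \<rightarrow>\<^sub>E UNIV.
        of_bool ((x j, x k, x l) = (a, b, z)) * (\<Prod>v\<in>A \<union> B. ?c v x))"
      unfolding pmf_map_markov[OF supp mk] V(1)[symmetric] ..
    also have "\<dots> = (\<Sum>u\<in>A \<rightarrow>\<^sub>E UNIV. \<Sum>w\<in>B \<rightarrow>\<^sub>E UNIV.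
        (of_bool (u j = a \<and> u l = z) * (\<Prod>v\<in>A. ?c v u)) *
        (of_bool (w k = b) * (\<Prod>v\<in>B. ?c v (w(l := z)))))"
      unfolding sum_PiE_Un[OF V(2)]
    proof (intro sum.cong refl)
      fix u w :: "nat \<Rightarrow> bool"
      let ?x = "override_on u w B"
      have x: "?x j = u j" "?x k = w k" "?x l = u l"
        using jA kB lA by (auto simp: override_on_def)
      have "(\<Prod>v\<in>A. ?c v ?x) = (\<Prod>v\<in>A. ?c v u)"
        by (intro prod.cong refl cond_factor_cong)
          (use paA in \<open>auto simp: override_on_def A_def parents_def\<close>)
      moreover have "(\<Prod>v\<in>B. ?c v ?x) = (\<Prod>v\<in>B. ?c v (w(l := z)))" if "u l = z"
        by (intro prod.cong refl cond_factor_cong)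
          (use paB lA that in \<open>auto simp: override_on_def parents_def\<close>)
      ultimately show "of_bool ((?x j, ?x k, ?x l) = (a, b, z)) * (\<Prod>v\<in>A \<union> B. ?c v ?x) =
          (of_bool (u j = a \<and> u l = z) * (\<Prod>v\<in>A. ?c v u)) *
          (of_bool (w k = b) * (\<Prod>v\<in>B. ?c v (w(l := z))))"
        using fin V(2) x by (auto simp: prod.union_disjoint)
    qed
    also have "\<dots> = F a z * G b z" by (simp add: F_def G_def sum_product)
    finally show ?thesis .
  qed
  then show ?thesis by (rule m_ber_eq_0)
qed

lemma m_ber_swap:
  assumes "\<And>x y z. q (x, y, z) = q' (y, x, z)"
  shows "m_ber q = m_ber q'"
proof -
  have XZ: "mXZ q x z = mYZ q' x z" and YZ: "mYZ q x z = mXZ q' x z" for x z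
    by (simp_all add: mXZ_def mYZ_def assms)
  have Z: "mZ q z = mZ q' z" for z
    unfolding mZ_def assms by (rule sum.swap)
  show ?thesis
    unfolding m_ber_def assms XZ YZ Z
    by (rule sum.cong[OF refl], rule arg_cong2[where f = "(*)", OF refl],
        rule trans[OF sum.swap]) (simp add: mult.commute)
qed

lemma m_nodes_commute: "m_nodes p j k l = m_nodes p k j l"
proof (cases l)
  case None
  have "pmf (map_pmf (\<lambda>x. (x j, x k)) p) (a, b) = pmf (map_pmf (\<lambda>x. (x k, x j)) p) (b, a)" for a b
    unfolding pmf_map by (rule arg_cong[of _ _ "measure_pmf.prob p"]) auto
  then show ?thesis using None
    by (simp add: m_nodes_def m_ber0_def UNIV_bool mult.commute)
next
  case (Some i)
  have "pmf (map_pmf (\<lambda>x. (x j, x k, x i)) p) (a, b, z) =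
      pmf (map_pmf (\<lambda>x. (x k, x j, x i)) p) (b, a, z)" for a b z
    unfolding pmf_map by (rule arg_cong[of _ _ "measure_pmf.prob p"]) auto
  then show ?thesis using Some by (auto simp: m_nodes_def intro: m_ber_swap)
qed

text \<open>At a non-collider one of the two edges leaves \<open>l\<close>. Cutting it keeps the
  other endpoint attached to \<open>l\<close>.\<close>

lemma fork_m_nodes:
  assumes supp: "set_pmf p \<subseteq> {..<d} \<rightarrow>\<^sub>E UNIV" and mk: "markov d p E"
    and E: "E \<in> poly_forests d"
    and jl: "(j, l) \<in> skeleton E" "(k, l) \<in> skeleton E" "j \<noteq> k" "\<not> v_structure E j l k"
  shows "m_nodes p j k (Some l) = 0"
proof -
  have *: "m_nodes p j k (Some l) = 0" if "(l, k) \<in> E" "(j, l) \<in> skeleton E" "j \<noteq> k" for j k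
    using edge_cut_m_ber[OF supp mk E that(1), of j] that
    by (auto simp: m_nodes_def skeleton_def)
  have "(l, k) \<in> E \<or> (l, j) \<in> E"
    using jl by (auto simp: v_structure_forest[OF E] skeleton_def)
  then show ?thesis using * jl m_nodes_commute by metis
qed

lemma rtrancl_remove_edge:
  assumes "(a, b) \<in> E\<^sup>*" "(k, b) \<notin> E\<^sup>*"
  shows "(a, b) \<in> (E - {(l, k)})\<^sup>*"
  using assms(1)
proof (induction rule: converse_rtrancl_induct)
  case (step y z)
  then have "(y, z) \<in> E - {(l, k)}" using assms(2) by blast
  then show ?case using step.IH by (rule converse_rtrancl_into_rtrancl)
qed simp

text \<open>Without a common ancestor (a node counts as its own ancestor) the two ancestral sets are
  disjoint and \<open>None\<close> separates. Otherwise acyclicity provides one of the two nodes,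
  say \<open>k\<close>, that is not an ancestor of the other. The separating node is the parent
  \<open>l\<close> of \<open>k\<close> on a directed path from the common ancestor: after cutting
  \<open>l \<rightarrow> k\<close>, \<open>j\<close> is still linked to \<open>l\<close> through
  that ancestor.\<close>

lemma nonadjacent_m_nodes:
  assumes supp: "set_pmf p \<subseteq> {..<d} \<rightarrow>\<^sub>E UNIV" and mk: "markov d p E"
    and E: "E \<in> poly_forests d"
    and jk: "j < d" "k < d" "j \<noteq> k" "(j, k) \<notin> skeleton E"
  shows "\<exists>l\<in>cond_nodes d j k. m_nodes p j k l = 0"
proof (cases "\<exists>r. (r, j) \<in> E\<^sup>* \<and> (r, k) \<in> E\<^sup>*")
  case False
  have "{r. (r, i) \<in> E\<^sup>*} \<subseteq> {..<d}" if "i < d" for i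
  proof
    fix r assume "r \<in> {r. (r, i) \<in> E\<^sup>*}"
    then have "(r, i) \<in> E\<^sup>*" by simp
    then show "r \<in> {..<d}"
      by (cases rule: converse_rtranclE) (use that poly_forestsD(1)[OF E] in auto)
  qed
  moreover have "parents E v \<subseteq> {r. (r, i) \<in> E\<^sup>*}" if "(v, i) \<in> E\<^sup>*" for v i
  proof
    fix w assume "w \<in> parents E v"
    then have "(w, v) \<in> E" by (simp add: parents_def)
    then show "w \<in> {r. (r, i) \<in> E\<^sup>*}" using that by (simp add: converse_rtrancl_into_rtrancl)
  qed
  ultimately have "m_ber0 (pmf (map_pmf (\<lambda>x. (x j, x k)) p)) = 0"
    using jk False
    by (intro disjoint_ancestors_m_ber0[OF supp mk poly_forestsD(2)[OF E],
          of "{r. (r, j) \<in> E\<^sup>*}" "{r. (r, k) \<in> E\<^sup>*}"]) auto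
  then show ?thesis by (intro bexI[of _ None]) (auto simp: m_nodes_def cond_nodes_def)
next
  case True
  have *: "\<exists>l\<in>cond_nodes d j k. m_nodes p j k l = 0"
    if r: "(r, j) \<in> E\<^sup>*" "(r, k) \<in> E\<^sup>*" and kj: "(k, j) \<notin> E\<^sup>*" "(j, k) \<notin> skeleton E" for r j k
  proof -
    have "r \<noteq> k" using r kj by auto
    with r(2) obtain l where l: "(r, l) \<in> E\<^sup>*" "(l, k) \<in> E" by (meson rtranclE)
    have "(k, l) \<notin> E\<^sup>*" using acyclic_antisym[OF poly_forestsD(2)[OF E] l(2)] .
    then have rl: "(r, l) \<in> (E - {(l, k)})\<^sup>*" "(r, j) \<in> (E - {(l, k)})\<^sup>*"
      using rtrancl_remove_edge[OF l(1)] rtrancl_remove_edge[OF r(1) kj(1)] by auto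
    have sub: "(E - {(l, k)})\<^sup>* \<subseteq> (skeleton (E - {(l, k)}))\<^sup>*"
      "((E - {(l, k)})\<inverse>)\<^sup>* \<subseteq> (skeleton (E - {(l, k)}))\<^sup>*"
      by (intro rtrancl_mono; auto simp: skeleton_def)+
    have "(j, r) \<in> ((E - {(l, k)})\<inverse>)\<^sup>*" using rl(2) by (simp add: rtrancl_converse)
    then have "(j, l) \<in> (skeleton (E - {(l, k)}))\<^sup>*"
      using sub rl(1) by (blast intro: rtrancl_trans)
    then have "m_nodes p j k (Some l) = 0"
      using edge_cut_m_ber[OF supp mk E l(2)] by (simp add: m_nodes_def)
    moreover have "l \<noteq> j" "l \<noteq> k" "l < d"
      using l kj poly_forestsD(1)[OF E] poly_forests_asym[OF E l(2)] by (auto simp: skeleton_def)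
    ultimately show ?thesis by (auto simp: cond_nodes_def)
  qed
  from True obtain r where r: "(r, j) \<in> E\<^sup>*" "(r, k) \<in> E\<^sup>*" by blast
  show ?thesis
  proof (cases "(k, j) \<in> E\<^sup>*")
    case False
    then show ?thesis using * r jk by blast
  next
    case True
    then obtain w where "(k, w) \<in> E\<^sup>*" "(w, j) \<in> E" using jk(3) by (metis rtranclE)
    then have "(j, k) \<notin> E\<^sup>*"
      using acyclic_antisym[OF poly_forestsD(2)[OF E]] by (meson rtrancl_trans)
    then have "\<exists>l\<in>cond_nodes d k j. m_nodes p k j l = 0"
      using *[of r k j] r jk(4) skeleton_sym by blast
    then show ?thesis using m_nodes_commute by (simp add: cond_nodes_def insert_commute)
  qed
qed

section \<open>Accuracy of the plug-in tests\<close>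

text \<open>With the ratios \<open>v = b / s\<close> and \<open>u' = a' / s'\<close> in the unit
  interval, the difference telescopes into three terms with coefficients at most 1. No inverse power
  of \<open>s\<close> survives, so conditioning cells of tiny mass do no harm; the convention
  \<open>x / 0 = 0\<close> covers empty ones.\<close>

lemma abs_diff_mult_div_le:
  fixes a b s a' b' s' :: real
  assumes "0 \<le> a" "a \<le> s" "0 \<le> b" "b \<le> s" "0 \<le> a'" "a' \<le> s'" "0 \<le> b'" "b' \<le> s'"
  shows "\<bar>a * b / s - a' * b' / s'\<bar> \<le> \<bar>a - a'\<bar> + \<bar>b - b'\<bar> + \<bar>s - s'\<bar>"
proof -
  define v u' where "v = b / s" and "u' = a' / s'"
  have v: "b = v * s" "0 \<le> v" "v \<le> 1"
    using assms by (auto simp: v_def divide_le_eq_1)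
  have u': "a' = u' * s'" "0 \<le> u'" "u' \<le> 1"
    using assms by (auto simp: u'_def divide_le_eq_1)
  have uv: "0 \<le> u' * v" "u' * v \<le> 1" using u' v by (auto intro: mult_le_one)
  have uvs: "u' * v * s' = v * a'" "u' * v * s = u' * b"
    using u'(1) v(1) by (simp_all add: mult_ac)
  have "a * b / s = v * a" "a' * b' / s' = u' * b'"
    by (auto simp: v_def u'_def)
  then have "a * b / s - a' * b' / s' = v * (a - a') + (u' * v) * (s' - s) + u' * (b - b')"
    by (simp add: right_diff_distrib uvs)
  also have "\<bar>\<dots>\<bar> \<le> v * \<bar>a - a'\<bar> + (u' * v) * \<bar>s' - s\<bar> + u' * \<bar>b - b'\<bar>"
    using u' v uv by (intro abs_triangle_ineq[THEN order_trans] add_mono) (auto simp: abs_mult)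
  also have "\<dots> \<le> 1 * \<bar>a - a'\<bar> + 1 * \<bar>s' - s\<bar> + 1 * \<bar>b - b'\<bar>"
    using u' v uv by (intro add_mono mult_right_mono) auto
  finally show ?thesis by (simp add: abs_minus_commute)
qed

text \<open>Moving the weight \<open>mZ\<close> inside the absolute value leaves a single quotient,
  of the shape handled by \<open>abs_diff_mult_div_le\<close>.\<close>

lemma m_ber_nonneg_eq:
  assumes "\<And>v. q v \<ge> 0"
  shows "m_ber q = (\<Sum>z\<in>UNIV. \<Sum>x\<in>UNIV. \<Sum>y\<in>UNIV.
    \<bar>q (x, y, z) - mXZ q x z * mYZ q y z / mZ q z\<bar>)"
proof -
  have "mZ q z * \<bar>q (x, y, z) / mZ q z - (mXZ q x z / mZ q z) * (mYZ q y z / mZ q z)\<bar> =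
      \<bar>q (x, y, z) - mXZ q x z * mYZ q y z / mZ q z\<bar>" for x y z
  proof (cases "mZ q z = 0")
    case True
    then have "\<forall>x y. q (x, y, z) = 0"
      using assms by (simp add: mZ_def sum_nonneg_eq_0_iff sum_nonneg)
    then show ?thesis by (simp add: True)
  next
    case False
    have "mZ q z \<ge> 0" using assms by (auto simp: mZ_def intro!: sum_nonneg)
    then have "mZ q z * \<bar>q (x, y, z) / mZ q z - (mXZ q x z / mZ q z) * (mYZ q y z / mZ q z)\<bar> =
      \<bar>mZ q z * (q (x, y, z) / mZ q z - (mXZ q x z / mZ q z) * (mYZ q y z / mZ q z))\<bar>"
      by (simp add: abs_mult)
    also have "mZ q z * (q (x, y, z) / mZ q z - (mXZ q x z / mZ q z) * (mYZ q y z / mZ q z)) =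
        q (x, y, z) - mXZ q x z * mYZ q y z / mZ q z"
      using False by (simp add: right_diff_distrib)
    finally show ?thesis .
  qed
  then show ?thesis by (simp only: m_ber_def sum_distrib_left)
qed

text \<open>Eight cells, each contributing \<open>\<epsilon>\<close> for the cell itself and 2, 2
  and 4 times \<open>\<epsilon>\<close> for the three marginals, which sum 2, 2 and 4 cells:
  \<open>72 = 8 * 9\<close>.\<close>

lemma m_ber_perturbation:
  assumes q: "\<And>v. q v \<ge> 0" "\<And>v. q' v \<ge> 0" and \<epsilon>: "\<And>v. \<bar>q v - q' v\<bar> \<le> \<epsilon>"
  shows "\<bar>m_ber q - m_ber q'\<bar> \<le> 72 * \<epsilon>"
proof -
  let ?t = "\<lambda>q x y z. q (x, y, z) - mXZ q x z * mYZ q y z / mZ q z"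
  have bounds: "0 \<le> mXZ q x z" "mXZ q x z \<le> mZ q z" "0 \<le> mYZ q y z" "mYZ q y z \<le> mZ q z"
    if "\<And>v. q v \<ge> 0" for q x y z
  proof -
    note [simp] = that
    show "0 \<le> mXZ q x z" "0 \<le> mYZ q y z"
      by (auto simp: mXZ_def mYZ_def intro!: sum_nonneg)
    show "mXZ q x z \<le> mZ q z" "mYZ q y z \<le> mZ q z"
      by (cases x; cases y; simp add: mXZ_def mYZ_def mZ_def UNIV_bool)+
  qed
  have eps: "\<bar>mXZ q x z - mXZ q' x z\<bar> \<le> 2 * \<epsilon>" "\<bar>mYZ q y z - mYZ q' y z\<bar> \<le> 2 * \<epsilon>"
    "\<bar>mZ q z - mZ q' z\<bar> \<le> 4 * \<epsilon>" for x y z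
  proof -
    show "\<bar>mXZ q x z - mXZ q' x z\<bar> \<le> 2 * \<epsilon>"
      using \<epsilon>[of "(x, True, z)"] \<epsilon>[of "(x, False, z)"] by (simp add: mXZ_def UNIV_bool)
    show "\<bar>mYZ q y z - mYZ q' y z\<bar> \<le> 2 * \<epsilon>"
      using \<epsilon>[of "(True, y, z)"] \<epsilon>[of "(False, y, z)"] by (simp add: mYZ_def UNIV_bool)
    show "\<bar>mZ q z - mZ q' z\<bar> \<le> 4 * \<epsilon>"
      using \<epsilon>[of "(True, True, z)"] \<epsilon>[of "(False, True, z)"]
        \<epsilon>[of "(True, False, z)"] \<epsilon>[of "(False, False, z)"]
      by (simp add: mZ_def UNIV_bool)
  qed
  have t: "\<bar>\<bar>?t q x y z\<bar> - \<bar>?t q' x y z\<bar>\<bar> \<le> 9 * \<epsilon>" for x y z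
  proof -
    have "\<bar>mXZ q x z * mYZ q y z / mZ q z - mXZ q' x z * mYZ q' y z / mZ q' z\<bar> \<le>
        \<bar>mXZ q x z - mXZ q' x z\<bar> + \<bar>mYZ q y z - mYZ q' y z\<bar> + \<bar>mZ q z - mZ q' z\<bar>"
      by (intro abs_diff_mult_div_le bounds q)
    also have "\<dots> \<le> 2 * \<epsilon> + 2 * \<epsilon> + 4 * \<epsilon>" by (intro add_mono eps)
    finally have r: "\<bar>mXZ q x z * mYZ q y z / mZ q z - mXZ q' x z * mYZ q' y z / mZ q' z\<bar> \<le> 8 * \<epsilon>"
      by simp
    have "\<bar>\<bar>a - b\<bar> - \<bar>a' - b'\<bar>\<bar> \<le> \<bar>a - a'\<bar> + \<bar>b - b'\<bar>" for a b a' b' :: real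
      by linarith
    also have "\<bar>q (x, y, z) - q' (x, y, z)\<bar> +
        \<bar>mXZ q x z * mYZ q y z / mZ q z - mXZ q' x z * mYZ q' y z / mZ q' z\<bar> \<le> \<epsilon> + 8 * \<epsilon>"
      by (intro add_mono \<epsilon> r)
    finally show ?thesis by simp
  qed
  have "\<bar>m_ber q - m_ber q'\<bar> = \<bar>\<Sum>z\<in>UNIV. \<Sum>x\<in>UNIV. \<Sum>y\<in>UNIV. \<bar>?t q x y z\<bar> - \<bar>?t q' x y z\<bar>\<bar>"
    by (simp add: m_ber_nonneg_eq q sum_subtractf)
  also have "\<dots> \<le> (\<Sum>z\<in>(UNIV::bool set). \<Sum>x\<in>(UNIV::bool set). \<Sum>y\<in>(UNIV::bool set). 9 * \<epsilon>)"
    by (intro sum_abs[THEN order_trans] sum_mono t)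
  also have "\<dots> = 72 * \<epsilon>" by simp
  finally show ?thesis .
qed

lemma m_ber0_perturbation:
  assumes q: "\<And>v. q v \<ge> 0" "\<And>v. q' v \<ge> 0"
    and le1: "(\<Sum>v\<in>UNIV. q v) \<le> 1" "(\<Sum>v\<in>UNIV. q' v) \<le> 1"
    and \<epsilon>: "\<And>v. \<bar>q v - q' v\<bar> \<le> \<epsilon>"
  shows "\<bar>m_ber0 q - m_ber0 q'\<bar> \<le> 20 * \<epsilon>"
proof -
  let ?X = "\<lambda>q x. \<Sum>y\<in>UNIV. q (x, y)" and ?Y = "\<lambda>q y. \<Sum>x\<in>UNIV. q (x, y)"
  let ?t = "\<lambda>q x y. q (x, y) - ?X q x * ?Y q y"
  have bounds: "0 \<le> ?X q x" "?X q x \<le> 1" "0 \<le> ?Y q y" "?Y q y \<le> 1"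
    if q: "\<And>v. q v \<ge> 0" and le1: "(\<Sum>v\<in>UNIV. q v) \<le> (1::real)" for q :: "bool \<times> bool \<Rightarrow> real" and x y
  proof -
    have "q (True, True) + q (True, False) + q (False, True) + q (False, False) \<le> 1"
      using le1 by (simp add: UNIV_Times_UNIV[symmetric] sum.cartesian_product[symmetric] UNIV_bool
          del: UNIV_Times_UNIV)
    then show "0 \<le> ?X q x" "?X q x \<le> 1" "0 \<le> ?Y q y" "?Y q y \<le> 1"
      using q[of "(True, True)"] q[of "(True, False)"] q[of "(False, True)"] q[of "(False, False)"]
      by (cases x; cases y; simp add: UNIV_bool)+
  qed
  have eps: "\<bar>?X q x - ?X q' x\<bar> \<le> 2 * \<epsilon>" "\<bar>?Y q y - ?Y q' y\<bar> \<le> 2 * \<epsilon>" for x y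
    using \<epsilon>[of "(x, True)"] \<epsilon>[of "(x, False)"] \<epsilon>[of "(True, y)"] \<epsilon>[of "(False, y)"]
    by (simp_all add: UNIV_bool)
  \<comment> \<open>The product of marginals is treated as a quotient with both denominators equal
    to 1, so each of the four cells costs \<open>1 + 2 + 2\<close>.\<close>
  have t: "\<bar>\<bar>?t q x y\<bar> - \<bar>?t q' x y\<bar>\<bar> \<le> 5 * \<epsilon>" for x y
    using abs_diff_mult_div_le[OF bounds[OF q(1) le1(1)] bounds[OF q(2) le1(2)], of x y x y]
      eps(1)[of x] eps(2)[of y] \<epsilon>[of "(x, y)"] by simp
  have "\<bar>m_ber0 q - m_ber0 q'\<bar> = \<bar>\<Sum>x\<in>UNIV. \<Sum>y\<in>UNIV. \<bar>?t q x y\<bar> - \<bar>?t q' x y\<bar>\<bar>"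
    by (simp add: m_ber0_def sum_subtractf)
  also have "\<dots> \<le> (\<Sum>x\<in>(UNIV::bool set). \<Sum>y\<in>(UNIV::bool set). 5 * \<epsilon>)"
    by (intro sum_abs[THEN order_trans] sum_mono t)
  also have "\<dots> = 20 * \<epsilon>" by simp
  finally show ?thesis .
qed

section \<open>Hoeffding bounds for empirical frequencies\<close>

lemma iid_event_count:
  "map_pmf (\<lambda>s. card {i \<in> {..<n}. Q (s i)}) (iid n p) =
    binomial_pmf n (measure_pmf.prob p {x. Q x})"
proof -
  have "bernoulli_pmf (measure_pmf.prob p {x. Q x}) = map_pmf Q p"
  proof (rule pmf_eqI)
    fix b
    have "measure_pmf.prob p {x. \<not> Q x} = 1 - measure_pmf.prob p {x. Q x}"
      using measure_pmf.prob_compl[of "{x. Q x}" p] by (simp add: Collect_neg_eq Compl_eq_Diff_UNIV)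
    then show "pmf (bernoulli_pmf (measure_pmf.prob p {x. Q x})) b = pmf (map_pmf Q p) b"
      by (cases b) (auto simp: pmf_map vimage_def)
  qed
  \<comment> \<open>Applying \<open>Q\<close> pointwise turns the dummy value outside the sample
    into \<open>Q undefined\<close>, so this must be the default of the coin sequence.\<close>
  then have "Pi_pmf {..<n} (Q undefined) (\<lambda>_. bernoulli_pmf (measure_pmf.prob p {x. Q x})) =
      map_pmf (\<lambda>h. Q \<circ> h) (iid n p)"
    unfolding iid_def by (simp add: Pi_pmf_map)
  then show ?thesis
    by (subst binomial_pmf_altdef'[of "{..<n}" n _ "Q undefined"])
      (auto simp: pmf.map_comp o_def)
qed

lemma iid_frequency_concentration:
  assumes "n > 0" "\<epsilon> \<ge> 0"
  shows "measure_pmf.prob (iid n p)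
    {s. \<bar>real (card {i. i < n \<and> Q (s i)}) / real n - measure_pmf.prob p {x. Q x}\<bar> \<ge> \<epsilon>}
    \<le> 2 * exp (- 2 * real n * \<epsilon>\<^sup>2)"
proof -
  let ?p = "measure_pmf.prob p {x. Q x}"
  interpret binomial_distribution n ?p by unfold_locales auto
  have "measure_pmf.prob (binomial_pmf n ?p) {x. \<bar>real x / real n - ?p\<bar> \<ge> \<epsilon>} \<le>
      2 * exp (- 2 * real n * \<epsilon>\<^sup>2)"
    using prob_abs_ge'[OF assms] by simp
  then show ?thesis
    by (simp add: iid_event_count[symmetric] vimage_def)
qed

lemma emp_concentration:
  fixes h :: "'a \<Rightarrow> 'b::finite"
  assumes "n > 0" "\<epsilon> \<ge> 0"
  shows "measure_pmf.prob (iid n p)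
    {s. \<exists>v. \<bar>emp n (\<lambda>i. h (s i)) v - pmf (map_pmf h p) v\<bar> \<ge> \<epsilon>}
    \<le> real CARD('b) * (2 * exp (- 2 * real n * \<epsilon>\<^sup>2))"
proof -
  let ?B = "\<lambda>v. {s. \<bar>emp n (\<lambda>i. h (s i)) v - pmf (map_pmf h p) v\<bar> \<ge> \<epsilon>}"
  have "measure_pmf.prob (iid n p) (\<Union>v\<in>UNIV. ?B v) \<le>
      (\<Sum>v\<in>UNIV. measure_pmf.prob (iid n p) (?B v))"
    by (rule measure_pmf.finite_measure_subadditive_finite) auto
  also have "\<dots> \<le> (\<Sum>v\<in>(UNIV :: 'b set). 2 * exp (- 2 * real n * \<epsilon>\<^sup>2))"
    using iid_frequency_concentration[OF assms, of p]
    by (intro sum_mono) (simp add: emp_def pmf_map vimage_def)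
  also have "(\<Union>v\<in>UNIV. ?B v) = {s. \<exists>v. \<bar>emp n (\<lambda>i. h (s i)) v - pmf (map_pmf h p) v\<bar> \<ge> \<epsilon>}"
    by auto
  finally show ?thesis by simp
qed

lemma emp_nonneg: "emp n s v \<ge> 0"
  by (simp add: emp_def)

lemma plug_in_accurate:
  assumes "n > 0" "\<epsilon> \<ge> 0"
  shows "measure_pmf.prob (iid n p) {s. \<bar>m_ber (emp n s) - m_ber (pmf p)\<bar> > 72 * \<epsilon>}
    \<le> 16 * exp (- 2 * real n * \<epsilon>\<^sup>2)"
proof -
  have "{s. \<bar>m_ber (emp n s) - m_ber (pmf p)\<bar> > 72 * \<epsilon>}
      \<subseteq> {s. \<exists>v. \<bar>emp n (\<lambda>i. s i) v - pmf (map_pmf (\<lambda>x. x) p) v\<bar> \<ge> \<epsilon>}"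
  proof (safe, rule ccontr)
    fix s assume s: "\<bar>m_ber (emp n s) - m_ber (pmf p)\<bar> > 72 * \<epsilon>"
      and "\<nexists>v. \<epsilon> \<le> \<bar>emp n (\<lambda>i. s i) v - pmf (map_pmf (\<lambda>x. x) p) v\<bar>"
    then have "\<bar>emp n (\<lambda>i. s i) v - pmf (map_pmf (\<lambda>x. x) p) v\<bar> \<le> \<epsilon>" for v
      by (meson linorder_le_cases)
    then have "\<bar>emp n s v - pmf p v\<bar> \<le> \<epsilon>" for v by simp
    then have "\<bar>m_ber (emp n s) - m_ber (pmf p)\<bar> \<le> 72 * \<epsilon>"
      by (intro m_ber_perturbation) (auto simp: emp_nonneg)
    with s show False by simp
  qed
  then have "measure_pmf.prob (iid n p) {s. \<bar>m_ber (emp n s) - m_ber (pmf p)\<bar> > 72 * \<epsilon>} \<le>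
    measure_pmf.prob (iid n p) {s. \<exists>v. \<bar>emp n (\<lambda>i. s i) v - pmf (map_pmf (\<lambda>x. x) p) v\<bar> \<ge> \<epsilon>}"
    by (intro measure_pmf.finite_measure_mono) auto
  also have "\<dots> \<le> 16 * exp (- 2 * real n * \<epsilon>\<^sup>2)"
    using emp_concentration[OF assms, of p "\<lambda>x. x"] by simp
  finally show ?thesis .
qed

lemma cond_indep_m_ber:
  assumes "cond_indep p"
  shows "m_ber (pmf p) = 0"
proof -
  have "mZ (pmf p) z \<ge> 0" for z by (auto simp: mZ_def intro!: sum_nonneg)
  then have "mZ (pmf p) z * \<bar>pmf p (x, y, z) / mZ (pmf p) z -
      (mXZ (pmf p) x z / mZ (pmf p) z) * (mYZ (pmf p) y z / mZ (pmf p) z)\<bar> = 0" for x y z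
    using assms unfolding cond_indep_def by (cases "mZ (pmf p) z = 0") (auto simp: less_le)
  then show ?thesis unfolding m_ber_def sum_distrib_left by (intro sum.neutral ballI)
qed

lemma test_error_psi_ber:
  assumes "n > 0" "r > 0"
  shows "test_error n r (psi_ber r n) \<le> ennreal (32 * exp (- 2 * real n * (r / 150)\<^sup>2))"
proof -
  \<comment> \<open>The accuracy \<open>r / 150\<close> gives deviation
    \<open>72 * r / 150 = 0.48 * r\<close>, strictly below the distance \<open>r / 2\<close> from
    the threshold to either hypothesis. The factor 16 is two tails times eight cells.\<close>
  let ?e = "16 * exp (- 2 * real n * (r / 150)\<^sup>2)"
  have acc: "measure_pmf.prob (iid n p) {s. \<bar>m_ber (emp n s) - m_ber (pmf p)\<bar> > 72 * (r / 150)} \<le> ?e"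
    for p using assms by (intro plug_in_accurate) auto
  have "(SUP p\<in>H0. emeasure (measure_pmf (iid n p)) {s. psi_ber r n s}) \<le> ennreal ?e"
  proof (rule SUP_least)
    fix p assume "p \<in> H0"
    then have "m_ber (pmf p) = 0" by (simp add: H0_def cond_indep_m_ber)
    then have "measure_pmf.prob (iid n p) {s. psi_ber r n s} \<le>
      measure_pmf.prob (iid n p) {s. \<bar>m_ber (emp n s) - m_ber (pmf p)\<bar> > 72 * (r / 150)}"
      using assms by (intro measure_pmf.finite_measure_mono) (auto simp: psi_ber_def)
    with acc[of p] show "emeasure (measure_pmf (iid n p)) {s. psi_ber r n s} \<le> ennreal ?e"
      by (simp add: measure_pmf.emeasure_eq_measure ennreal_leI)
  qed
  moreover have "(SUP p\<in>H1 r. emeasure (measure_pmf (iid n p)) {s. \<not> psi_ber r n s}) \<le> ennreal ?e"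
  proof (rule SUP_least)
    fix p assume "p \<in> H1 r"
    then have "m_ber (pmf p) \<ge> r" by (simp add: H1_def)
    then have "measure_pmf.prob (iid n p) {s. \<not> psi_ber r n s} \<le>
      measure_pmf.prob (iid n p) {s. \<bar>m_ber (emp n s) - m_ber (pmf p)\<bar> > 72 * (r / 150)}"
      using assms by (intro measure_pmf.finite_measure_mono) (auto simp: psi_ber_def)
    with acc[of p] show "emeasure (measure_pmf (iid n p)) {s. \<not> psi_ber r n s} \<le> ennreal ?e"
      by (simp add: measure_pmf.emeasure_eq_measure ennreal_leI)
  qed
  ultimately have "test_error n r (psi_ber r n) \<le> ennreal ?e + ennreal ?e"
    unfolding test_error_def by (rule add_mono)
  also have "\<dots> = ennreal (32 * exp (- 2 * real n * (r / 150)\<^sup>2))"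
    by (subst ennreal_plus[symmetric]) auto
  finally show ?thesis .
qed

lemma test_error_psi_ber_radius:
  assumes "n \<ge> 1"
  shows "test_error n (2400 * real n powr (- 1 / 2)) (psi_ber (2400 * real n powr (- 1 / 2)) n)
    \<le> ennreal (1 / 10)"
proof -
  let ?r = "2400 * real n powr (- 1 / 2)"
  have "(real n powr (- 1 / 2))\<^sup>2 = real n powr (- 1)"
    by (simp add: power2_eq_square flip: powr_add)
  also have "\<dots> = 1 / real n"
    using assms by (simp add: powr_minus_divide)
  \<comment> \<open>Here \<open>2400 / 150 = 16\<close> and \<open>2 * 16^2 = 512\<close>. The
    constant is generous because the exponential is then bounded only by
    \<open>exp x \<ge> 1 + x\<close>.\<close>
  finally have "2 * real n * (?r / 150)\<^sup>2 = 512"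
    using assms by (simp add: power_divide power_mult_distrib)
  then have "- 2 * real n * (?r / 150)\<^sup>2 = - 512" by linarith
  then have "32 * exp (- 2 * real n * (?r / 150)\<^sup>2) = 32 / exp 512"
    by (simp only: exp_minus divide_inverse)
  also have "\<dots> \<le> 32 / 513"
    using exp_ge_add_one_self[of 512] by (intro divide_left_mono) auto
  also have "\<dots> \<le> 1 / 10" by simp
  finally have "ennreal (32 * exp (- 2 * real n * (?r / 150)\<^sup>2)) \<le> ennreal (1 / 10)"
    by (rule ennreal_leI)
  moreover have "test_error n ?r (psi_ber ?r n) \<le> ennreal (32 * exp (- 2 * real n * (?r / 150)\<^sup>2))"
    using assms by (intro test_error_psi_ber) auto
  ultimately show ?thesis by (rule order_trans[rotated])
qed

section \<open>Error of PC-tree with the plug-in test\<close>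

definition m_hat :: "nat \<Rightarrow> (nat \<Rightarrow> nat \<Rightarrow> bool) \<Rightarrow> nat \<Rightarrow> nat \<Rightarrow> nat option \<Rightarrow> real" where
  "m_hat n s j k l = (case l of
     None \<Rightarrow> m_ber0 (emp n (\<lambda>i. (s i j, s i k)))
   | Some h \<Rightarrow> m_ber (emp n (\<lambda>i. (s i j, s i k, s i h))))"

lemma ber_outcomes_m_hat: "ber_outcomes c n s j k l \<longleftrightarrow> m_hat n s j k l \<ge> c / 2"
  by (cases l) (auto simp: ber_outcomes_def m_hat_def psi_ber_def psi_ber0_def)

lemma emp_pair_eq_sum:
  "emp n (\<lambda>i. (f i, g i)) (a, b) = (\<Sum>z\<in>UNIV. emp n (\<lambda>i. (f i, g i, h i)) (a, b, z :: bool))"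
proof -
  have "{i. i < n \<and> (f i, g i) = (a, b)} = {i. i < n \<and> (f i, g i, h i) = (a, b, True)} \<union>
      {i. i < n \<and> (f i, g i, h i) = (a, b, False)}"
    by auto
  moreover have "card \<dots> = card {i. i < n \<and> (f i, g i, h i) = (a, b, True)} +
      card {i. i < n \<and> (f i, g i, h i) = (a, b, False)}"
    by (intro card_Un_disjoint) auto
  ultimately show ?thesis by (simp add: emp_def UNIV_bool add_divide_distrib)
qed

lemma pmf_pair_eq_sum:
  "pmf (map_pmf (\<lambda>x. (f x, g x)) p) (a, b) =
    (\<Sum>z\<in>UNIV. pmf (map_pmf (\<lambda>x. (f x, g x, h x)) p) (a, b, z :: bool))"
proof -
  have "(\<lambda>x. (f x, g x)) -` {(a, b)} = (\<lambda>x. (f x, g x, h x)) -` {(a, b, True)} \<union>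
      (\<lambda>x. (f x, g x, h x)) -` {(a, b, False)}"
    by auto
  moreover have "measure_pmf.prob p \<dots> = measure_pmf.prob p ((\<lambda>x. (f x, g x, h x)) -` {(a, b, True)}) +
      measure_pmf.prob p ((\<lambda>x. (f x, g x, h x)) -` {(a, b, False)})"
    by (intro measure_pmf.finite_measure_Union) auto
  ultimately show ?thesis by (simp add: pmf_map UNIV_bool)
qed

lemma sum_emp_le_1: "(\<Sum>v\<in>UNIV. emp n s (v :: 'b::finite)) \<le> 1"
proof -
  have "(\<Sum>v\<in>UNIV. card {i. i < n \<and> s i = v}) = card (\<Union>v\<in>UNIV. {i. i < n \<and> s i = v})"
    by (intro card_UN_disjoint[symmetric]) auto
  also have "(\<Union>v\<in>UNIV. {i. i < n \<and> s i = v}) = {..<n}" by auto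
  finally have "real (\<Sum>v\<in>UNIV. card {i. i < n \<and> s i = v}) = real n" by simp
  then have "(\<Sum>v\<in>UNIV. real (card {i. i < n \<and> s i = v})) = real n" by simp
  then show ?thesis by (simp add: emp_def flip: sum_divide_distrib)
qed

lemma m_hat_accurate:
  assumes \<epsilon>: "\<And>j k l v. j < d \<Longrightarrow> k < d \<Longrightarrow> l < d \<Longrightarrow>
      \<bar>emp n (\<lambda>i. (s i j, s i k, s i l)) v - pmf (map_pmf (\<lambda>x. (x j, x k, x l)) p) v\<bar> \<le> \<epsilon>"
    and jk: "j < d" "k < d" "l \<in> cond_nodes d j k"
  shows "\<bar>m_hat n s j k l - m_nodes p j k l\<bar> \<le> 72 * \<epsilon>"
proof (cases l)
  case None
  have "0 \<le> \<epsilon>" using \<epsilon>[OF jk(1) jk(2) jk(1)] by (meson abs_ge_zero order_trans)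
  \<comment> \<open>Pair frequencies are marginals of triple frequencies whose third index repeats
    \<open>j\<close>, so no third node has to exist. Two triple cells per pair cell give
    \<open>20 * 2 = 40\<close>, within 72.\<close>
  have "\<bar>emp n (\<lambda>i. (s i j, s i k)) v - pmf (map_pmf (\<lambda>x. (x j, x k)) p) v\<bar> \<le> 2 * \<epsilon>" for v
  proof -
    obtain a b where v: "v = (a, b)" by force
    show ?thesis
      using \<epsilon>[OF jk(1) jk(2) jk(1), of "(a, b, True)"] \<epsilon>[OF jk(1) jk(2) jk(1), of "(a, b, False)"]
      unfolding v emp_pair_eq_sum[of n _ _ a b "\<lambda>i. s i j"] pmf_pair_eq_sum[of _ _ p a b "\<lambda>x. x j"]
      by (simp add: UNIV_bool)
  qed
  then have "\<bar>m_ber0 (emp n (\<lambda>i. (s i j, s i k))) - m_ber0 (pmf (map_pmf (\<lambda>x. (x j, x k)) p))\<bar>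
      \<le> 20 * (2 * \<epsilon>)"
    by (intro m_ber0_perturbation sum_emp_le_1) (auto simp: emp_nonneg sum_pmf_eq_1)
  then show ?thesis using \<open>0 \<le> \<epsilon>\<close> by (simp add: None m_hat_def m_nodes_def)
next
  case (Some i)
  then have "i < d" using jk by (auto simp: cond_nodes_def)
  then show ?thesis
    unfolding Some m_hat_def m_nodes_def option.case
    by (intro m_ber_perturbation \<epsilon> jk) (auto simp: emp_nonneg)
qed

lemma m_nodes_min_max: "m_nodes p (min j k) (max j k) l = m_nodes p j k l"
  by (cases "j \<le> k") (auto simp: m_nodes_commute[of p j] min_def max_def)

lemma cond_nodes_min_max: "cond_nodes d (min j k) (max j k) = cond_nodes d j k"
  by (cases "j \<le> k") (auto simp: cond_nodes_def min_def max_def)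

text \<open>The deterministic half of the guarantee. Strict accuracy matters at population value 0,
  since the test already rejects when the statistic equals \<open>c / 2\<close>.\<close>

lemma pc_tree_correct_if_accurate:
  assumes F: "(p, E) \<in> F_ber d c" and "c > 0"
    and acc: "\<And>j k l. j < d \<Longrightarrow> k < d \<Longrightarrow> j \<noteq> k \<Longrightarrow> l \<in> cond_nodes d j k \<Longrightarrow>
      \<bar>m_hat n s j k l - m_nodes p j k l\<bar> < c / 2"
    and out: "pc_tree_output d (ber_outcomes c n s) H"
  shows "H = cpdag d E"
proof (rule pc_tree_output_correct[OF _ _ _ _ _ out])
  show E: "E \<in> poly_forests d" using F by (simp add: F_ber_def)
  have supp: "set_pmf p \<subseteq> {..<d} \<rightarrow>\<^sub>E UNIV" and mk: "markov d p E"
    and st: "strong_tree_faithful d c p E"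
    using F by (auto simp: F_ber_def)
  have acc': "\<bar>m_hat n s (min j k) (max j k) l - m_nodes p j k l\<bar> < c / 2"
    if "j < d" "k < d" "j \<noteq> k" "l \<in> cond_nodes d j k" for j k l
    using acc[of "min j k" "max j k" l] that
    by (simp add: m_nodes_min_max cond_nodes_min_max)
  have rej: "ber_outcomes c n s (min j k) (max j k) l"
    if "j < d" "k < d" "j \<noteq> k" "l \<in> cond_nodes d j k" "m_nodes p j k l \<ge> c" for j k l
    using acc'[OF that(1-4)] that(5) unfolding ber_outcomes_m_hat by linarith
  have acpt: "\<not> ber_outcomes c n s (min j k) (max j k) l"
    if "j < d" "k < d" "j \<noteq> k" "l \<in> cond_nodes d j k" "m_nodes p j k l = 0" for j k l
    using acc'[OF that(1-4)] that(5) unfolding ber_outcomes_m_hat by linarith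
  show "ber_outcomes c n s (min j k) (max j k) l"
    if "(j, k) \<in> skeleton E" "l \<in> cond_nodes d j k" for j k l
    using st that skeleton_less[OF E that(1)] skeleton_irrefl[OF E that(1)] m_nodes_commute[of p j k l]
    by (intro rej) (auto simp: strong_tree_faithful_def)
  have triple: "j < d" "k < d" "Some l \<in> cond_nodes d j k"
    if "(j, l) \<in> skeleton E" "(k, l) \<in> skeleton E" for j k l
    using skeleton_less[OF E that(1)] skeleton_less[OF E that(2)]
      skeleton_irrefl[OF E that(1)] skeleton_irrefl[OF E that(2)]
    by (auto simp: cond_nodes_def)
  show "ber_outcomes c n s (min k j) (max k j) (Some l)" if v: "v_structure E k l j" for k l j
  proof -
    have "(k, l) \<in> skeleton E" "(j, l) \<in> skeleton E" "k \<noteq> j"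
      using v by (auto simp: v_structure_def skeleton_def)
    with triple[of k l j] show ?thesis
      using st v by (intro rej) (auto simp: strong_tree_faithful_def)
  qed
  show "\<exists>l\<in>cond_nodes d j k. \<not> ber_outcomes c n s (min j k) (max j k) l"
    if "j < d" "k < d" "j \<noteq> k" "(j, k) \<notin> skeleton E" for j k
    using nonadjacent_m_nodes[OF supp mk E that] acpt that by blast
  show "\<not> ber_outcomes c n s (min j k) (max j k) (Some l)"
    if "(j, l) \<in> skeleton E" "(k, l) \<in> skeleton E" "j \<noteq> k" "\<not> v_structure E j l k" for j l k
    using triple[OF that(1,2)] fork_m_nodes[OF supp mk E that] that by (intro acpt) auto
qed

lemma pc_tree_error_le:
  assumes d: "d \<ge> 2" and c: "c > 0" and n: "real n \<ge> 135000 * ln (real d) / c\<^sup>2"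
    and pc: "is_pc_tree d c n Ghat"
  shows "learn_error d c n Ghat \<le> ennreal (1 / 10)"
  unfolding learn_error_def
proof (rule SUP_least, clarify)
  fix p E assume F: "(p, E) \<in> F_ber d c"
  \<comment> \<open>As in the test, \<open>72 / 150 < 1 / 2\<close>. The sample size makes the
    exponent \<open>2 * n * \<epsilon>^2\<close> at least \<open>12 * ln d\<close>, because
    \<open>135000 = 12 * 150^2 / 2\<close>. The union bound over \<open>d^3\<close> triples is then
    \<open>16 / d^9\<close>, at most \<open>1 / 32\<close> for \<open>d \<ge> 2\<close>.\<close>
  define \<epsilon> where "\<epsilon> = c / 150"
  have "ln (real d) > 0" using d by simp
  then have "135000 * ln (real d) / c\<^sup>2 > 0" using c by simp
  then have "n > 0" using n by simp
  define T where "T = {..<d} \<times> {..<d} \<times> {..<d}"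
  define Bad where "Bad = (\<lambda>(j, k, l). {s. \<exists>v. \<bar>emp n (\<lambda>i. (s i j, s i k, s i l)) v -
      pmf (map_pmf (\<lambda>x. (x j, x k, x l)) p) v\<bar> \<ge> \<epsilon>})"
  have "{s. Ghat s \<noteq> cpdag d E} \<subseteq> (\<Union>t\<in>T. Bad t)"
  proof (rule subsetI, rule ccontr)
    fix s assume s: "s \<in> {s. Ghat s \<noteq> cpdag d E}" "s \<notin> (\<Union>t\<in>T. Bad t)"
    have "\<bar>m_hat n s j k l - m_nodes p j k l\<bar> \<le> 72 * \<epsilon>"
      if "j < d" "k < d" "l \<in> cond_nodes d j k" for j k l
      by (rule m_hat_accurate[OF _ that])
        (use s(2) in \<open>auto simp: T_def Bad_def not_le intro: less_imp_le\<close>)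
    moreover have "72 * \<epsilon> < c / 2" using c by (simp add: \<epsilon>_def)
    ultimately have "\<bar>m_hat n s j k l - m_nodes p j k l\<bar> < c / 2"
      if "j < d" "k < d" "l \<in> cond_nodes d j k" for j k l
      using that by (meson le_less_trans)
    moreover have "pc_tree_output d (ber_outcomes c n s) (Ghat s)"
      using pc by (simp add: is_pc_tree_def)
    ultimately have "Ghat s = cpdag d E"
      using pc_tree_correct_if_accurate[OF F c] by blast
    with s(1) show False by simp
  qed
  then have "measure_pmf.prob (iid n p) {s. Ghat s \<noteq> cpdag d E} \<le>
      measure_pmf.prob (iid n p) (\<Union>t\<in>T. Bad t)"
    by (intro measure_pmf.finite_measure_mono) auto
  also have "\<dots> \<le> (\<Sum>t\<in>T. measure_pmf.prob (iid n p) (Bad t))"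
    by (rule measure_pmf.finite_measure_subadditive_finite) (auto simp: T_def)
  also have "\<dots> \<le> (\<Sum>t\<in>T. 16 * exp (- 2 * real n * \<epsilon>\<^sup>2))"
  proof (rule sum_mono)
    fix t :: "nat \<times> nat \<times> nat"
    obtain j k l where t: "t = (j, k, l)" by (cases t)
    show "measure_pmf.prob (iid n p) (Bad t) \<le> 16 * exp (- 2 * real n * \<epsilon>\<^sup>2)"
      using emp_concentration[OF \<open>n > 0\<close>, of \<epsilon> p "\<lambda>x. (x j, x k, x l)"] c
      by (simp add: t Bad_def \<epsilon>_def)
  qed
  also have "\<dots> = 16 * real d ^ 3 * exp (- 2 * real n * \<epsilon>\<^sup>2)"
    by (simp add: T_def power3_eq_cube)
  also have "\<dots> \<le> 16 * real d ^ 3 * exp (- (12 * ln (real d)))"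
  proof -
    have "135000 * ln (real d) \<le> real n * c\<^sup>2" using n c by (simp add: pos_divide_le_eq)
    then show ?thesis by (intro mult_left_mono) (simp_all add: \<epsilon>_def power_divide)
  qed
  also have "\<dots> = 16 / real d ^ 9"
  proof -
    have "12 * ln (real d) = ln (real d ^ 12)" using d by (subst ln_realpow) auto
    then have "exp (- (12 * ln (real d))) = inverse (real d ^ 12)"
      using d by (simp only: exp_minus) (subst exp_ln, auto)
    also have "real d ^ 12 = real d ^ 3 * real d ^ 9" by (simp flip: power_add)
    finally have e: "exp (- (12 * ln (real d))) = inverse (real d ^ 3 * real d ^ 9)" .
    have *: "16 * a * inverse (a * b) = 16 / b" if "a \<noteq> 0" for a b :: real
      using that by (simp add: divide_inverse)
    show ?thesis unfolding e by (rule *) (use d in simp)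
  qed
  also have "\<dots> \<le> 16 / 2 ^ 9"
  proof -
    have "(2::real) ^ 9 \<le> real d ^ 9" using d by (intro power_mono) auto
    then show ?thesis by (intro divide_left_mono) (use d in auto)
  qed
  also have "\<dots> \<le> 1 / 10" by simp
  finally show "emeasure (measure_pmf (iid n p)) {s. Ghat s \<noteq> cpdag d E} \<le> ennreal (1 / 10)"
    by (simp add: measure_pmf.emeasure_eq_measure ennreal_leI)
qed

text \<open>With one node there are no pairs to test, so accuracy is vacuous and even
  \<open>n = 0\<close> works, in agreement with \<open>ln 1 = 0\<close>.\<close>

lemma pc_tree_error_single_node:
  assumes "c > 0" "is_pc_tree 1 c n Ghat"
  shows "learn_error 1 c n Ghat = 0"
proof -
  have "Ghat s = cpdag 1 E" if "(p, E) \<in> F_ber 1 c" for p E s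
    using assms by (intro pc_tree_correct_if_accurate[OF that]) (auto simp: is_pc_tree_def)
  then have "learn_error 1 c n Ghat \<le> 0"
    unfolding learn_error_def by (intro SUP_least) auto
  then show ?thesis by simp
qed

section \<open>Lower bounds\<close>

text \<open>Cauchy-Schwarz applied to the likelihood ratio, whose second moment tensorizes.\<close>

lemma iid_change_of_measure:
  fixes p q :: "'a pmf"
  assumes fin: "finite (set_pmf p)" and w: "\<And>x. pmf q x = w x * pmf p x"
  shows "(measure_pmf.prob (iid n q) A)\<^sup>2 \<le>
    measure_pmf.prob (iid n p) A * (measure_pmf.expectation p (\<lambda>x. (w x)\<^sup>2)) ^ n"
proof -
  let ?P = "iid n p" and ?Q = "iid n q"
  define L where "L s = (\<Prod>i<n. w (s i))" for s :: "nat \<Rightarrow> 'a"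
  define S where "S = set_pmf ?P"
  have finS: "finite S"
    unfolding S_def iid_def by (subst set_Pi_pmf) (auto intro!: finite_PiE_dflt fin)
  have Q: "pmf ?Q s = L s * pmf ?P s" for s
    by (auto simp: iid_def pmf_Pi L_def w prod.distrib)
  then have SQ: "set_pmf ?Q \<subseteq> S" by (auto simp: S_def set_pmf_iff)
  have prob_sum: "measure_pmf.prob r A = (\<Sum>s\<in>S \<inter> A. pmf r s)" if "set_pmf r \<subseteq> S" for r
  proof -
    have "measure_pmf.prob r A = measure_pmf.prob r (S \<inter> A)"
      using that by (intro measure_pmf.finite_measure_eq_AE) (auto simp: AE_measure_pmf_iff)
    then show ?thesis using finS by (simp add: measure_measure_pmf_finite)
  qed
  \<comment> \<open>The split is chosen so that the first Cauchy-Schwarz factor is the probability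
    of \<open>A\<close> under \<open>?P\<close>, and the second is part of the second moment of
    \<open>L\<close>.\<close>
  have "(measure_pmf.prob ?Q A)\<^sup>2 = (\<Sum>s\<in>S \<inter> A. sqrt (pmf ?P s) * (L s * sqrt (pmf ?P s)))\<^sup>2"
    by (simp add: prob_sum[OF SQ] Q mult.left_commute)
  also have "\<dots> \<le> (\<Sum>s\<in>S \<inter> A. (sqrt (pmf ?P s))\<^sup>2) * (\<Sum>s\<in>S \<inter> A. (L s * sqrt (pmf ?P s))\<^sup>2)"
    by (rule Cauchy_Schwarz_ineq_sum)
  also have "\<dots> = measure_pmf.prob ?P A * (\<Sum>s\<in>S \<inter> A. (L s)\<^sup>2 * pmf ?P s)"
    by (simp add: prob_sum S_def power_mult_distrib)
  also have "\<dots> \<le> measure_pmf.prob ?P A * (\<Sum>s\<in>S. (L s)\<^sup>2 * pmf ?P s)"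
    using finS by (intro mult_left_mono sum_mono2) auto
  also have "(\<Sum>s\<in>S. (L s)\<^sup>2 * pmf ?P s) = measure_pmf.expectation ?P (\<lambda>s. (L s)\<^sup>2)"
    using finS by (intro integral_measure_pmf_real[symmetric]) (auto simp: S_def)
  also have "\<dots> = measure_pmf.expectation ?P (\<lambda>s. \<Prod>i<n. (w (s i))\<^sup>2)"
    by (simp add: L_def prod_power_distrib)
  also have "\<dots> = (measure_pmf.expectation p (\<lambda>x. (w x)\<^sup>2)) ^ n"
    unfolding iid_def
    by (subst expectation_prod_Pi_pmf) (auto intro: integrable_measure_pmf_finite fin)
  finally show ?thesis .
qed

section \<open>The hard instances: fair coins and one tilted pair\<close>

definition unif :: "nat \<Rightarrow> (nat \<Rightarrow> bool) pmf" where
  "unif d = Pi_pmf {..<d} undefined (\<lambda>_. bernoulli_pmf (1 / 2))"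

text \<open>Fair coins, except that \<open>x k = x 0\<close> has probability \<open>(1 + c) / 2\<close>.\<close>

definition tilted :: "nat \<Rightarrow> nat \<Rightarrow> real \<Rightarrow> (nat \<Rightarrow> bool) pmf" where
  "tilted d k c = map_pmf (\<lambda>x. x(k := (x k = x 0)))
     (Pi_pmf {..<d} undefined (\<lambda>v. bernoulli_pmf (if v = k then (1 + c) / 2 else 1 / 2)))"

text \<open>The likelihood ratio of \<open>tilted d k c\<close> against \<open>unif d\<close>, as a
  function of the values at nodes 0 and \<open>k\<close>.\<close>

definition tilt :: "real \<Rightarrow> bool \<Rightarrow> bool \<Rightarrow> real" where
  "tilt c a b = 1 + c * (if a = b then 1 else -1)"

lemma prob_Pi_pmf_cylinder:
  assumes "A \<subseteq> {..<d}"
  shows "measure_pmf.prob (Pi_pmf {..<d} undefined B) (cylinder A x) = (\<Prod>v\<in>A. pmf (B v) (x v))"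
proof -
  have "cylinder A x = Pi {..<d} (\<lambda>v. if v \<in> A then {x v} else UNIV)"
    using assms by (auto simp: cylinder_def Pi_def)
  then have "measure_pmf.prob (Pi_pmf {..<d} undefined B) (cylinder A x) =
      (\<Prod>v<d. measure_pmf.prob (B v) (if v \<in> A then {x v} else UNIV))"
    by (simp add: measure_Pi_pmf_Pi)
  also have "\<dots> = (\<Prod>v\<in>A. measure_pmf.prob (B v) (if v \<in> A then {x v} else UNIV))"
    using assms by (intro prod.mono_neutral_right) auto
  also have "\<dots> = (\<Prod>v\<in>A. pmf (B v) (x v))"
    by (intro prod.cong refl) (auto simp: measure_pmf_single)
  finally show ?thesis .
qed

lemma prob_unif_cylinder:
  "A \<subseteq> {..<d} \<Longrightarrow> measure_pmf.prob (unif d) (cylinder A x) = (1 / 2) ^ card A"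
  unfolding unif_def by (simp add: prob_Pi_pmf_cylinder)

text \<open>The flip turns a cylinder into a cylinder only if coordinate 0 is fixed whenever
  \<open>k\<close> is; \<open>0 < k\<close> keeps coordinate 0 itself unchanged. This covers every
  event needed below.\<close>

lemma prob_tilted_cylinder:
  assumes A: "A \<subseteq> {..<d}" "k \<in> A \<Longrightarrow> 0 \<in> A" and k: "0 < k" and c: "0 \<le> c" "c \<le> 1"
  shows "measure_pmf.prob (tilted d k c) (cylinder A x) =
    (1 / 2) ^ card A * (if k \<in> A then tilt c (x 0) (x k) else 1)"
proof -
  let ?T = "\<lambda>x. x(k := (x k = x 0)) :: nat \<Rightarrow> bool"
  have fin: "finite A" using A by (auto intro: finite_subset)
  have "?T -` cylinder A x = cylinder A (?T x)"
    using A k by (cases "k \<in> A") (auto simp: cylinder_def split: if_splits)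
  then have "measure_pmf.prob (tilted d k c) (cylinder A x) =
      (\<Prod>v\<in>A. pmf (bernoulli_pmf (if v = k then (1 + c) / 2 else 1 / 2)) (?T x v))"
    using A unfolding tilted_def by (simp add: prob_Pi_pmf_cylinder del: fun_upd_apply)
  also have "\<dots> = (\<Prod>v\<in>A. 1 / 2 * (if v = k then tilt c (x 0) (x k) else 1))"
    using c by (intro prod.cong refl) (auto simp: tilt_def field_simps)
  also have "\<dots> = (1 / 2) ^ card A * (if k \<in> A then tilt c (x 0) (x k) else 1)"
    by (simp only: prod.distrib prod_constant prod.delta[OF fin])
  finally show ?thesis .
qed

lemma set_Pi_pmf_lessThan:
  fixes d :: nat and B :: "nat \<Rightarrow> 'b pmf"
  shows "set_pmf (Pi_pmf {..<d} undefined B) \<subseteq> {..<d} \<rightarrow>\<^sub>E UNIV"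
proof -
  have "{f. \<forall>v. v \<notin> {..<d} \<longrightarrow> f v = undefined} = {..<d} \<rightarrow>\<^sub>E (UNIV :: 'b set)"
    by (auto simp: PiE_def extensional_def)
  then show ?thesis using set_Pi_pmf_subset[of "{..<d}" undefined B] by simp
qed

lemma set_pmf_unif: "set_pmf (unif d) \<subseteq> {..<d} \<rightarrow>\<^sub>E UNIV"
  unfolding unif_def by (rule set_Pi_pmf_lessThan)

lemma set_pmf_tilted:
  assumes "k < d"
  shows "set_pmf (tilted d k c) \<subseteq> {..<d} \<rightarrow>\<^sub>E UNIV"
proof
  fix x assume "x \<in> set_pmf (tilted d k c)"
  then obtain y where y: "y \<in> {..<d} \<rightarrow>\<^sub>E UNIV" "x = y(k := (y k = y 0))"
    unfolding tilted_def set_map_pmf using set_Pi_pmf_lessThan by blast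
  then show "x \<in> {..<d} \<rightarrow>\<^sub>E UNIV" using assms by (auto simp: PiE_def extensional_def)
qed

lemma pmf_eq_prob_cylinder:
  assumes "set_pmf p \<subseteq> {..<d} \<rightarrow>\<^sub>E UNIV" "x \<in> {..<d} \<rightarrow>\<^sub>E UNIV"
  shows "pmf p x = measure_pmf.prob p (cylinder {..<d} x)"
proof -
  have "y = x" if "y \<in> cylinder {..<d} x" "y \<in> {..<d} \<rightarrow>\<^sub>E UNIV" for y
    using that assms(2) by (auto simp: cylinder_def PiE_def extensional_def fun_eq_iff)
  then have "measure_pmf.prob p (cylinder {..<d} x) = measure_pmf.prob p {x}"
    using assms by (intro measure_pmf.finite_measure_eq_AE)
      (auto simp: AE_measure_pmf_iff cylinder_def)
  then show ?thesis by (simp add: measure_pmf_single)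
qed

lemma pmf_unif: "x \<in> {..<d} \<rightarrow>\<^sub>E UNIV \<Longrightarrow> pmf (unif d) x = (1 / 2) ^ d"
  by (simp add: pmf_eq_prob_cylinder[OF set_pmf_unif] prob_unif_cylinder)

lemma pmf_tilted:
  assumes "0 < k" "k < d" "0 \<le> c" "c \<le> 1"
  shows "pmf (tilted d k c) x = tilt c (x 0) (x k) * pmf (unif d) x"
proof (cases "x \<in> {..<d} \<rightarrow>\<^sub>E UNIV")
  case True
  then show ?thesis
    using assms
    by (simp add: pmf_eq_prob_cylinder[OF set_pmf_tilted] prob_tilted_cylinder pmf_unif)
next
  case False
  then have "x \<notin> set_pmf (tilted d k c)" "x \<notin> set_pmf (unif d)"
    using set_pmf_tilted[of k d c] set_pmf_unif[of d] assms by blast+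
  then show ?thesis by (simp add: set_pmf_iff)
qed

lemma markov_unif: "markov d (unif d) {}"
  unfolding markov_def by (simp add: parents_def pmf_unif prob_unif_cylinder)

text \<open>All conditional factors equal \<open>1 / 2\<close> except that of \<open>k\<close> given
  0, which carries the whole likelihood ratio.\<close>

lemma markov_tilted:
  assumes "0 < k" "k < d" "0 \<le> c" "c \<le> 1"
  shows "markov d (tilted d k c) {(0, k)}"
  unfolding markov_def
proof
  fix x :: "nat \<Rightarrow> bool" assume x: "x \<in> {..<d} \<rightarrow>\<^sub>E UNIV"
  have "measure_pmf.prob (tilted d k c) (cylinder (insert v (parents {(0, k)} v)) x) /
      measure_pmf.prob (tilted d k c) (cylinder (parents {(0, k)} v) x) =
      1 / 2 * (if v = k then tilt c (x 0) (x k) else 1)" if "v < d" for v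
  proof -
    note cyl = prob_tilted_cylinder[OF _ _ assms(1,3,4), of _ d x]
    show ?thesis
    proof (cases "v = k")
      case True
      then have pa: "parents {(0, k)} k = {0}" by (auto simp: parents_def)
      have p2: "measure_pmf.prob (tilted d k c) (cylinder {k, 0} x) = tilt c (x 0) (x k) / 4"
        using assms cyl[of "{k, 0}"] by (simp add: power2_eq_square)
      have p1: "measure_pmf.prob (tilted d k c) (cylinder {0} x) = 1 / 2"
        using assms cyl[of "{0}"] by simp
      show ?thesis unfolding True pa p2 p1 by simp
    next
      case False
      then have pa: "parents {(0, k)} v = {}" by (auto simp: parents_def)
      have p1: "measure_pmf.prob (tilted d k c) (cylinder {v} x) = 1 / 2"
        using False assms that cyl[of "{v}"] by simp
      have p0: "measure_pmf.prob (tilted d k c) (cylinder {} x) = 1"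
        using cyl[of "{}"] by simp
      show ?thesis unfolding pa p1 p0 using False by simp
    qed
  qed
  then have "(\<Prod>v<d. measure_pmf.prob (tilted d k c) (cylinder (insert v (parents {(0, k)} v)) x) /
      measure_pmf.prob (tilted d k c) (cylinder (parents {(0, k)} v) x)) =
      (\<Prod>v<d. 1 / 2 * (if v = k then tilt c (x 0) (x k) else 1))"
    by (intro prod.cong) auto
  also have "\<dots> = (1 / 2) ^ d * tilt c (x 0) (x k)"
    using assms by (simp only: prod.distrib prod_constant) simp
  also have "\<dots> = pmf (tilted d k c) x"
    using x assms by (simp add: pmf_tilted pmf_unif)
  finally show "pmf (tilted d k c) x = (\<Prod>v<d.
      measure_pmf.prob (tilted d k c) (cylinder (insert v (parents {(0, k)} v)) x) /
      measure_pmf.prob (tilted d k c) (cylinder (parents {(0, k)} v) x))" ..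
qed

lemma pmf_tilted_pair:
  assumes "0 < k" "k < d" "0 \<le> c" "c \<le> 1"
  shows "pmf (map_pmf (\<lambda>x. (x 0, x k)) (tilted d k c)) (a, b) = tilt c a b / 4"
proof -
  have "(\<lambda>x. (x 0, x k)) -` {(a, b)} = cylinder {0, k} ((\<lambda>_. a)(k := b))"
    using assms by (auto simp: cylinder_def)
  then show ?thesis
    using assms by (simp add: pmf_map prob_tilted_cylinder power2_eq_square)
qed

lemma pmf_tilted_triple:
  assumes "0 < k" "k < d" "0 \<le> c" "c \<le> 1" "l < d" "l \<noteq> 0" "l \<noteq> k"
  shows "pmf (map_pmf (\<lambda>x. (x 0, x k, x l)) (tilted d k c)) (a, b, z) = tilt c a b / 8"
proof -
  have "(\<lambda>x. (x 0, x k, x l)) -` {(a, b, z)} = cylinder {0, k, l} ((\<lambda>_. a)(k := b, l := z))"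
    using assms by (auto simp: cylinder_def)
  then show ?thesis
    using assms by (simp add: pmf_map prob_tilted_cylinder power3_eq_cube eval_nat_numeral)
qed

lemma pmf_unif_triple:
  assumes "0 < k" "k < d" "l < d" "l \<noteq> 0" "l \<noteq> k"
  shows "pmf (map_pmf (\<lambda>x. (x 0, x k, x l)) (unif d)) (a, b, z) = 1 / 8"
proof -
  have "(\<lambda>x. (x 0, x k, x l)) -` {(a, b, z)} = cylinder {0, k, l} ((\<lambda>_. a)(k := b, l := z))"
    using assms by (auto simp: cylinder_def)
  then show ?thesis
    using assms by (simp add: pmf_map prob_unif_cylinder eval_nat_numeral)
qed

lemma pmf_unif_pair:
  assumes "0 < k" "k < d"
  shows "pmf (map_pmf (\<lambda>x. (x 0, x k)) (unif d)) (a, b) = 1 / 4"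
proof -
  have "(\<lambda>x. (x 0, x k)) -` {(a, b)} = cylinder {0, k} ((\<lambda>_. a)(k := b))"
    using assms by (auto simp: cylinder_def)
  then show ?thesis
    using assms by (simp add: pmf_map prob_unif_cylinder power2_eq_square)
qed

text \<open>All marginals are uniform, so each of the eight cells deviates from the product by
  \<open>c / 8\<close>. The tilted law thus has dependence exactly \<open>c\<close>, on the boundary
  of the alternative.\<close>

lemma m_ber_tilt:
  assumes "c \<ge> 0" "\<And>a b z. q (a, b, z) = tilt c a b / 8"
  shows "m_ber q = c"
proof -
  have XZ: "mXZ q x z = 1 / 4" and YZ: "mYZ q x z = 1 / 4" and Z: "mZ q z = 1 / 2" for x z
    by (cases x; simp add: mXZ_def mYZ_def mZ_def UNIV_bool assms(2) tilt_def field_simps)+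
  show ?thesis
    unfolding m_ber_def XZ YZ Z using assms(1)
    by (simp add: UNIV_bool assms(2) tilt_def add_divide_distrib diff_divide_distrib)
qed

lemma m_ber0_tilt:
  assumes "c \<ge> 0" "\<And>a b. q (a, b) = tilt c a b / 4"
  shows "m_ber0 q = c"
proof -
  have X: "(\<Sum>y\<in>UNIV. q (x, y)) = 1 / 2" and Y: "(\<Sum>y\<in>UNIV. q (y, x)) = 1 / 2" for x
    by (cases x; simp add: UNIV_bool assms(2) tilt_def field_simps)+
  show ?thesis
    unfolding m_ber0_def X Y using assms(1)
    by (simp add: UNIV_bool assms(2) tilt_def add_divide_distrib diff_divide_distrib)
qed

lemma m_nodes_tilted:
  assumes "0 < k" "k < d" "0 \<le> c" "c \<le> 1" "l \<in> cond_nodes d 0 k"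
  shows "m_nodes (tilted d k c) 0 k l = c"
  using assms
  by (cases l) (auto simp: m_nodes_def cond_nodes_def
      intro!: m_ber0_tilt m_ber_tilt pmf_tilted_pair pmf_tilted_triple)

lemma empty_poly_forest: "{} \<in> poly_forests d"
proof -
  have "xs = [a]" if "skel_path {} a b xs" for a b xs
    using that by (cases xs rule: remdups_adj.cases) (auto simp: skel_path_def skeleton_def)
  then have "xs = ys" if "skel_path {} a b xs" "skel_path {} a b ys" for a b xs ys
    using that by metis
  moreover have "acyclic {}" by (simp add: acyclic_def)
  ultimately show ?thesis by (simp add: poly_forests_def is_dag_def)
qed

lemma edge_poly_forest:
  assumes "0 < k" "k < d"
  shows "{(0, k)} \<in> poly_forests d"
proof -
  have "xs = (if a = b then [a] else [a, b])" if xs: "skel_path {(0, k)} a b xs" for a b xs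
  proof -
    consider "xs = []" | u where "xs = [u]" | u v where "xs = [u, v]"
      | u v w ys where "xs = u # v # w # ys"
      by (metis list.exhaust)
    then show ?thesis
      by cases (use xs in \<open>auto simp: skel_path_def skeleton_def\<close>)
  qed
  then have "xs = ys" if "skel_path {(0, k)} a b xs" "skel_path {(0, k)} a b ys" for a b xs ys
    using that by metis
  moreover have "acyclic ({} :: (nat \<times> nat) set)" by (simp add: acyclic_def)
  then have "acyclic {(0, k)}" using assms by simp
  ultimately show ?thesis using assms by (simp add: poly_forests_def is_dag_def)
qed

lemma unif_in_F_ber: "(unif d, {}) \<in> F_ber d c"
  using set_pmf_unif[of d] markov_unif[of d] empty_poly_forest
  by (auto simp: F_ber_def P_ber_def strong_tree_faithful_def skeleton_def v_structure_def)

lemma tilted_in_F_ber: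
  assumes "0 < k" "k < d" "0 \<le> c" "c \<le> 1"
  shows "(tilted d k c, {(0, k)}) \<in> F_ber d c"
proof -
  have "strong_tree_faithful d c (tilted d k c) {(0, k)}"
    using assms m_nodes_tilted[OF assms] m_nodes_commute[of "tilted d k c" k 0]
    by (auto simp: strong_tree_faithful_def skeleton_def v_structure_def cond_nodes_def insert_commute)
  then show ?thesis
    using set_pmf_tilted[OF assms(2)] markov_tilted[OF assms] edge_poly_forest[OF assms(1,2)]
    by (auto simp: F_ber_def P_ber_def)
qed

lemma finite_set_pmf_unif: "finite (set_pmf (unif d))"
proof (rule finite_subset[OF set_pmf_unif])
  show "finite ({..<d} \<rightarrow>\<^sub>E (UNIV :: bool set))" by (intro finite_PiE) auto
qed

text \<open>The average of \<open>(1 + c)^2\<close> and \<open>(1 - c)^2\<close>, equally likely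
  under fair coins.\<close>

lemma expectation_tilt_sq:
  assumes "0 < k" "k < d"
  shows "measure_pmf.expectation (unif d) (\<lambda>x. (tilt c (x 0) (x k))\<^sup>2) = 1 + c\<^sup>2"
proof -
  have "measure_pmf.expectation (unif d) (\<lambda>x. (tilt c (x 0) (x k))\<^sup>2) =
      measure_pmf.expectation (map_pmf (\<lambda>x. (x 0, x k)) (unif d)) (\<lambda>(a, b). (tilt c a b)\<^sup>2)"
    by simp
  also have "\<dots> = (\<Sum>v\<in>UNIV \<times> UNIV. (case v of (a, b) \<Rightarrow> (tilt c a b)\<^sup>2) *
      pmf (map_pmf (\<lambda>x. (x 0, x k)) (unif d)) v)"
    by (intro integral_measure_pmf_real) auto
  also have "\<dots> = (\<Sum>a\<in>UNIV. \<Sum>b\<in>UNIV. (tilt c a b)\<^sup>2 / 4)"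
    unfolding sum.cartesian_product using pmf_unif_pair[OF assms]
    by (intro sum.cong) auto
  also have "\<dots> = 1 + c\<^sup>2"
    by (simp add: UNIV_bool tilt_def power2_eq_square field_simps)
  finally show ?thesis .
qed

section \<open>Minimax lower bounds for learning and testing\<close>

lemma one_plus_power_le_exp: "(1 + c\<^sup>2) ^ n \<le> exp (real n * c\<^sup>2)" for c :: real
  using power_mono[OF exp_ge_add_one_self[of "c\<^sup>2"], of n] by (simp add: exp_of_nat_mult)

text \<open>Many-hypotheses version of Le Cam's argument: the uniform law against the \<open>d - 1\<close> laws with one
  edge at node \<open>0\<close>. The events of correct recovery are disjoint, so their probabilities under the
  uniform law add up to at most \<open>1/10\<close>.\<close>

lemma learn_error_lower_bound:
  assumes d: "d \<ge> 2" and c: "0 < c" "c \<le> 1" and err: "learn_error d c n Ghat \<le> ennreal (1 / 10)"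
  shows "ln (real d) / c\<^sup>2 \<le> real n"
proof -
  have err': "measure_pmf.prob (iid n p) {s. Ghat s \<noteq> cpdag d E} \<le> 1 / 10"
    if "(p, E) \<in> F_ber d c" for p E
  proof -
    have "emeasure (measure_pmf (iid n p)) {s. Ghat s \<noteq> cpdag d E} \<le> learn_error d c n Ghat"
      using SUP_upper[OF that, of "\<lambda>(p, E). emeasure (measure_pmf (iid n p)) {s. Ghat s \<noteq> cpdag d E}"]
      by (simp add: learn_error_def)
    also note err
    finally show ?thesis by (simp add: measure_pmf.emeasure_eq_measure)
  qed
  define A where "A k = {s. Ghat s = cpdag d {(0, k)}}" for k
  have prob_A: "(9 / 10)\<^sup>2 \<le> measure_pmf.prob (iid n (unif d)) (A k) * exp (real n * c\<^sup>2)"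
    if k: "k \<in> {1..<d}" for k
  proof -
    have k': "0 < k" "k < d" using k by auto
    have "measure_pmf.prob (iid n (tilted d k c)) (- A k) \<le> 1 / 10"
      using err'[OF tilted_in_F_ber[OF k']] c by (simp add: A_def Collect_neg_eq)
    then have "9 / 10 \<le> measure_pmf.prob (iid n (tilted d k c)) (A k)"
      using measure_pmf.prob_compl[of "A k" "iid n (tilted d k c)"] by (simp add: Compl_eq_Diff_UNIV)
    then have "(9 / 10)\<^sup>2 \<le> (measure_pmf.prob (iid n (tilted d k c)) (A k))\<^sup>2"
      by (intro power_mono) auto
    also have "\<dots> \<le> measure_pmf.prob (iid n (unif d)) (A k) * (1 + c\<^sup>2) ^ n"
      using iid_change_of_measure[OF finite_set_pmf_unif
          pmf_tilted[OF k' less_imp_le[OF c(1)] c(2)], of n "A k"]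
      by (simp add: expectation_tilt_sq[OF k'])
    also have "\<dots> \<le> measure_pmf.prob (iid n (unif d)) (A k) * exp (real n * c\<^sup>2)"
      by (intro mult_left_mono one_plus_power_le_exp) auto
    finally show ?thesis .
  qed
  \<comment> \<open>The CPDAGs of different single edges already differ in their skeletons, hence
    the recovery events are disjoint.\<close>
  have "j = k" if "cpdag d {(0, j)} = cpdag d {(0, k)}" "j > 0" for j k
  proof -
    have "skeleton {(0, j)} = skeleton {(0, k)}" using that(1) by (simp add: cpdag_def)
    moreover have "(0, j) \<in> skeleton {(0, j)}" by (simp add: skeleton_def)
    ultimately have "(0, j) \<in> skeleton {(0, k)}" by simp
    then show ?thesis using that(2) by (auto simp: skeleton_def)
  qed
  then have disj: "disjoint_family_on A {1..<d}"
    by (fastforce simp: disjoint_family_on_def A_def)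
  have "(\<Sum>k\<in>{1..<d}. measure_pmf.prob (iid n (unif d)) (A k)) =
      measure_pmf.prob (iid n (unif d)) (\<Union>k\<in>{1..<d}. A k)"
    using disj by (intro measure_pmf.finite_measure_finite_Union[symmetric]) auto
  also have "\<dots> \<le> measure_pmf.prob (iid n (unif d)) {s. Ghat s \<noteq> cpdag d {}}"
    by (intro measure_pmf.finite_measure_mono) (auto simp: A_def cpdag_def skeleton_def)
  also have "\<dots> \<le> 1 / 10" by (rule err'[OF unif_in_F_ber])
  finally have sum_A: "(\<Sum>k\<in>{1..<d}. measure_pmf.prob (iid n (unif d)) (A k)) \<le> 1 / 10" .
  have "real (d - 1) * (9 / 10)\<^sup>2 = (\<Sum>k\<in>{1..<d}. (9 / 10)\<^sup>2)" by simp
  also have "\<dots> \<le> (\<Sum>k\<in>{1..<d}. measure_pmf.prob (iid n (unif d)) (A k) * exp (real n * c\<^sup>2))"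
    by (intro sum_mono prob_A)
  also have "\<dots> = (\<Sum>k\<in>{1..<d}. measure_pmf.prob (iid n (unif d)) (A k)) * exp (real n * c\<^sup>2)"
    by (rule sum_distrib_right[symmetric])
  also have "\<dots> \<le> 1 / 10 * exp (real n * c\<^sup>2)"
    by (intro mult_right_mono sum_A) auto
  \<comment> \<open>The chain gives \<open>8.1 * (d - 1) \<le> exp (n * c^2)\<close>, and
    \<open>d \<le> 8.1 * (d - 1)\<close> for \<open>d \<ge> 2\<close>; so the lower bound has
    constant 1.\<close>
  finally have "real d \<le> exp (real n * c\<^sup>2)"
    using d by (simp add: power2_eq_square of_nat_diff)
  then have "ln (real d) \<le> ln (exp (real n * c\<^sup>2))" using d by (subst ln_le_cancel_iff) auto
  then have "ln (real d) \<le> real n * c\<^sup>2" by simp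
  then show ?thesis using c by (simp add: pos_divide_le_eq)
qed

lemma test_error_lower_bound:
  assumes r: "0 < r" "r \<le> 1" and small: "real n * r\<^sup>2 \<le> 1"
  shows "test_error n r \<psi> \<ge> ennreal (1 / 5)"
proof (rule ccontr)
  assume "\<not> test_error n r \<psi> \<ge> ennreal (1 / 5)"
  then have less: "test_error n r \<psi> < ennreal (1 / 5)" by simp
  let ?h = "\<lambda>x :: nat \<Rightarrow> bool. (x 0, x 1, x 2)"
  \<comment> \<open>The learning instances on three nodes are reused; node 2 is an independent
    conditioning variable.\<close>
  define p where "p = map_pmf ?h (unif 3)"
  define q where "q = map_pmf ?h (tilted 3 1 r)"
  have p: "pmf p (a, b, z) = 1 / 8" for a b z
    unfolding p_def by (rule pmf_unif_triple) auto
  have q: "pmf q (a, b, z) = tilt r a b / 8" for a b z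
    unfolding q_def using r by (intro pmf_tilted_triple) auto
  have "p \<in> H0"
    by (simp add: H0_def P_ber_def cond_indep_def p mXZ_def mYZ_def mZ_def UNIV_bool)
  have "m_ber (pmf q) = r" using r by (intro m_ber_tilt q) auto
  then have "q \<in> H1 r" by (simp add: H1_def P_ber_def)
  define a where "a = measure_pmf.prob (iid n p) {s. \<psi> s}"
  define b where "b = measure_pmf.prob (iid n q) {s. \<not> \<psi> s}"
  have "ennreal a + ennreal b \<le> test_error n r \<psi>"
    unfolding test_error_def a_def b_def measure_pmf.emeasure_eq_measure[symmetric]
    by (intro add_mono SUP_upper \<open>p \<in> H0\<close> \<open>q \<in> H1 r\<close>)
  moreover have "a \<ge> 0" "b \<ge> 0" by (auto simp: a_def b_def)
  ultimately have "ennreal (a + b) < ennreal (1 / 5)"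
    using less by (simp only: ennreal_plus)
  then have ab: "a + b < 1 / 5" using \<open>a \<ge> 0\<close> \<open>b \<ge> 0\<close> by (simp only: ennreal_less_iff)
  have "measure_pmf.prob (iid n q) {s. \<psi> s} = 1 - b"
    using measure_pmf.prob_compl[of "{s. \<psi> s}" "iid n q"]
    by (simp add: b_def Collect_neg_eq Compl_eq_Diff_UNIV)
  moreover have "4 / 5 \<le> 1 - b" using ab \<open>a \<ge> 0\<close> by simp
  ultimately have "(4 / 5)\<^sup>2 \<le> (measure_pmf.prob (iid n q) {s. \<psi> s})\<^sup>2"
    by (intro power_mono) auto
  also have "\<dots> \<le> a * (measure_pmf.expectation p (\<lambda>(a, b, z). (tilt r a b)\<^sup>2)) ^ n"
  proof -
    have "pmf q x = (case x of (a, b, z) \<Rightarrow> tilt r a b) * pmf p x" for x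
      by (cases x) (simp add: p q)
    from iid_change_of_measure[OF _ this, of n "{s. \<psi> s}"] show ?thesis
      by (simp add: a_def case_prod_unfold)
  qed
  also have "measure_pmf.expectation p (\<lambda>(a, b, z). (tilt r a b)\<^sup>2) = 1 + r\<^sup>2"
    unfolding p_def by (simp add: expectation_tilt_sq)
  also have "a * (1 + r\<^sup>2) ^ n \<le> a * exp (real n * r\<^sup>2)"
    using \<open>a \<ge> 0\<close> by (intro mult_left_mono one_plus_power_le_exp)
  also have "\<dots> \<le> a * exp 1" using \<open>a \<ge> 0\<close> small by (intro mult_left_mono) auto
  also have "\<dots> \<le> a * 3" using \<open>a \<ge> 0\<close> exp_le by (intro mult_left_mono) auto
  \<comment> \<open>Now \<open>16 / 25 \<le> 3 * a\<close>, so \<open>a \<ge> 16 / 75\<close>, which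
    exceeds \<open>1 / 5\<close>. Any error level strictly above \<open>1 / 10\<close> serves for
    the radius.\<close>
  finally show False using ab \<open>b \<ge> 0\<close> by (simp add: power2_eq_square)
qed

lemma test_radius_bounds:
  assumes "n \<ge> 1"
  shows "real n powr (- 1 / 2) \<le> test_radius n" "test_radius n \<le> 2400 * real n powr (- 1 / 2)"
proof -
  let ?u = "real n powr (- 1 / 2)"
  let ?S = "{r. r > 0 \<and> (INF \<psi>. test_error n r \<psi>) \<le> ennreal (1 / 10)}"
  have "?u > 0" using assms by simp
  have in_S: "2400 * ?u \<in> ?S"
    using test_error_psi_ber_radius[OF assms] \<open>?u > 0\<close>
    by (auto intro: INF_lower2)
  have ge: "?u \<le> r" if "r \<in> ?S" for r
  proof (rule ccontr)
    assume "\<not> ?u \<le> r"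
    then have less: "r < ?u" "r > 0" using that by auto
    have "?u\<^sup>2 = real n powr (- 1)" by (simp add: power2_eq_square flip: powr_add)
    then have u2: "real n * ?u\<^sup>2 = 1" using assms by (simp add: powr_minus_divide)
    \<comment> \<open>Places every smaller radius in the range \<open>r \<le> 1\<close> where the
      tilted law exists.\<close>
    have "?u \<le> 1" using assms powr_mono[of "- 1 / 2" 0 "real n"] by simp
    moreover have "real n * r\<^sup>2 \<le> real n * ?u\<^sup>2"
      using less by (intro mult_left_mono power_mono) auto
    ultimately have "ennreal (1 / 5) \<le> test_error n r \<psi>" for \<psi>
      using less u2 by (intro test_error_lower_bound) auto
    then have "ennreal (1 / 5) \<le> (INF \<psi>. test_error n r \<psi>)" by (rule INF_greatest)
    also have "\<dots> \<le> ennreal (1 / 10)" using that by simp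
    finally show False by (simp add: ennreal_le_iff)
  qed
  show "?u \<le> test_radius n"
    unfolding test_radius_def by (rule cInf_greatest) (use in_S ge in blast)+
  show "test_radius n \<le> 2400 * ?u"
    unfolding test_radius_def by (rule cInf_lower[OF in_S]) (rule bdd_belowI[OF ge])
qed

section \<open>Matching upper and lower bounds\<close>

definition pc_samples :: "nat \<times> real \<Rightarrow> nat" where
  "pc_samples = (\<lambda>(d, c). nat \<lceil>135000 * ln (real d) / c\<^sup>2\<rceil>)"

lemma pc_tree_error:
  assumes "(d, c) \<in> params" "is_pc_tree d c (pc_samples (d, c)) Ghat"
  shows "learn_error d c (pc_samples (d, c)) Ghat \<le> ennreal (1 / 10)"
proof (cases "d = 1")
  case True
  then show ?thesis using assms pc_tree_error_single_node by (simp add: params_def)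
next
  case False
  have "135000 * ln (real d) / c\<^sup>2 \<le> real (pc_samples (d, c))"
    by (simp add: pc_samples_def real_nat_ceiling_ge)
  then show ?thesis using assms False by (intro pc_tree_error_le) (auto simp: params_def)
qed

text \<open>Rounding up costs at most 1, which is absorbed as \<open>2 * ln d / c^2\<close>, since
  \<open>ln 2 \<ge> 1 / 2\<close> and \<open>c \<le> 1\<close>. For \<open>d = 1\<close> both sides
  vanish.\<close>

lemma pc_samples_le:
  assumes "(d, c) \<in> params"
  shows "real (pc_samples (d, c)) \<le> 135002 * (ln (real d) / c\<^sup>2)"
proof (cases "d = 1")
  case True
  then show ?thesis by (simp add: pc_samples_def)
next
  case False
  then have d: "d \<ge> 2" and c: "0 < c" "c \<le> 1" using assms by (auto simp: params_def)
  have "ln 2 \<le> ln (real d)" using d by simp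
  moreover have "1 / 2 \<le> ln (2 :: real)"
    using ln_le_minus_one[of "1 / 2 :: real"] by (simp add: ln_div)
  ultimately have "1 / 2 \<le> ln (real d)" by simp
  also have "\<dots> \<le> ln (real d) / c\<^sup>2"
    using c d by (simp add: pos_le_divide_eq power_le_one mult_left_le)
  finally have "1 \<le> 2 * (ln (real d) / c\<^sup>2)" by linarith
  moreover have "real (pc_samples (d, c)) \<le> 135000 * ln (real d) / c\<^sup>2 + 1"
    using d c by (simp add: pc_samples_def of_nat_nat)
  ultimately show ?thesis by simp
qed

lemma sample_complexity_bounds:
  assumes "(d, c) \<in> params"
  shows "ln (real d) / c\<^sup>2 \<le> real (sample_complexity d c)"
    "sample_complexity d c \<le> pc_samples (d, c)"
proof -
  let ?S = "{n. \<exists>Ghat. learn_error d c n Ghat \<le> ennreal (1 / 10)}"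
  obtain Ghat where "is_pc_tree d c (pc_samples (d, c)) Ghat"
    using is_pc_tree_exists by blast
  then have in_S: "pc_samples (d, c) \<in> ?S" using pc_tree_error[OF assms] by blast
  then show "sample_complexity d c \<le> pc_samples (d, c)"
    unfolding sample_complexity_def by (rule wellorder_Inf_le1)
  \<comment> \<open>An infimum of a nonempty set of naturals is attained, so the lower bound applies
    to an actual estimator at this sample size.\<close>
  have "sample_complexity d c \<in> ?S"
    unfolding sample_complexity_def using in_S by (intro Inf_nat_def1) blast
  then obtain Ghat' where "learn_error d c (sample_complexity d c) Ghat' \<le> ennreal (1 / 10)"
    by blast
  then show "ln (real d) / c\<^sup>2 \<le> real (sample_complexity d c)"
    using assms learn_error_lower_bound[of d c] by (cases "d = 1") (auto simp: params_def)
qed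

theorem theorem4p1:
  shows "optimal_test psi_ber
    \<and> order_equiv {1..} test_radius (\<lambda>n. real n powr (- 1 / 2))
    \<and> order_equiv params (\<lambda>(d, c). real (sample_complexity d c)) (\<lambda>(d, c). ln (real d) / c\<^sup>2)
    \<and> (\<exists>\<nu> :: nat \<times> real \<Rightarrow> nat.
          order_equiv params (\<lambda>t. real (\<nu> t)) (\<lambda>(d, c). real (sample_complexity d c)) \<and>
          (\<forall>(d, c)\<in>params. \<forall>Ghat. is_pc_tree d c (\<nu> (d, c)) Ghat \<longrightarrow>
             learn_error d c (\<nu> (d, c)) Ghat \<le> ennreal (1 / 10)))"
proof (intro conjI)
  show "optimal_test psi_ber"
    unfolding optimal_test_def
  proof (intro exI conjI allI impI)
    \<comment> \<open>The threshold lies between \<open>test_radius n\<close> and 2400 times it, by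
      the two bounds on the radius.\<close>
    show "order_equiv {1..} (\<lambda>n. 2400 * real n powr (- 1 / 2)) test_radius"
      unfolding order_equiv_def
      by (rule exI[of _ 1], rule conjI[OF zero_less_one], rule exI[of _ 2400])
        (use test_radius_bounds in auto)
    show "2400 * real n powr (- 1 / 2) > 0" if "n \<ge> 1" for n :: nat
      using that by simp
  qed (rule test_error_psi_ber_radius)
  show "order_equiv {1..} test_radius (\<lambda>n. real n powr (- 1 / 2))"
    unfolding order_equiv_def
    by (rule exI[of _ 1], rule conjI[OF zero_less_one], rule exI[of _ 2400])
      (use test_radius_bounds in auto)
  have upper: "real (sample_complexity d c) \<le> 135002 * (ln (real d) / c\<^sup>2)"
    if "(d, c) \<in> params" for d c
    using sample_complexity_bounds(2)[OF that] pc_samples_le[OF that] by linarith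
  then show "order_equiv params (\<lambda>(d, c). real (sample_complexity d c))
      (\<lambda>(d, c). ln (real d) / c\<^sup>2)"
    unfolding order_equiv_def
    by (intro exI[of _ 1] conjI zero_less_one exI[of _ 135002])
      (use sample_complexity_bounds(1) in auto)
  have "real (pc_samples (d, c)) \<le> 135002 * real (sample_complexity d c)"
    if "(d, c) \<in> params" for d c
    using sample_complexity_bounds(1)[OF that] pc_samples_le[OF that] by linarith
  then have "order_equiv params (\<lambda>t. real (pc_samples t)) (\<lambda>(d, c). real (sample_complexity d c))"
    unfolding order_equiv_def
    by (intro exI[of _ 1] conjI zero_less_one exI[of _ 135002])
      (use sample_complexity_bounds(2) in auto)
  then show "\<exists>\<nu> :: nat \<times> real \<Rightarrow> nat.
      order_equiv params (\<lambda>t. real (\<nu> t)) (\<lambda>(d, c). real (sample_complexity d c)) \<and>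
      (\<forall>(d, c)\<in>params. \<forall>Ghat. is_pc_tree d c (\<nu> (d, c)) Ghat \<longrightarrow>
         learn_error d c (\<nu> (d, c)) Ghat \<le> ennreal (1 / 10))"
    using pc_tree_error by blast
qed

end
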